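(* Let $\mathbb{F}$ be a field. Up to isomorphism there is a unique nilpotent symplectic alternating algebra $L$ over $\mathbb{F}$ of dimension $10$ with an isotropic center of dimension $2$ that is of class $7$ and has the further properties that $L^{4}L^{3}\neq L^{7}$ and $L^{5}L^{2}\not\leq L^{4}L^{3}$. The algebra can be given by the presentation $$\mathcal{P}_{10}^{(2,7)}:\ (x_{2}y_{3},y_{5})=1,\ (x_{3}y_{4},y_{5})=1,\ (x_{1}y_{2},y_{4})=1,\ (y_{1}y_{2},y_{3})=1.$$
   Context: A symplectic alternating algebra (SAA) over a field $\mathbb{F}$ is a finite-dimensional $\mathbb{F}$-vector space $L$ with a non-degenerate alternating bilinear form $(\cdot,\cdot)$ and a bilinear alternating product $L\times L\to L$, $(x,y)\mapsto xy$ (so $xx=0$), such that $(xy,z)=(yz,x)$ for all $x,y,z\in L$. Consequently $(u,v,w)\mapsto (uv,w)$ is an alternating trilinear form, and by non-degeneracy it determines the product. An isomorphism of SAAs is a linear bijection preserving both the product and the form. For subspaces $A,B\le L$, $AB$ denotes the linear span of all products $ab$ with $a\in A$, $b\in B$. Put $L^{1}=L$, $L^{k+1}=L^{k}L$; $L$ is nilpotent if $L^{k+1}=0$ for some $k$, and the smallest such $k$ is its (nilpotence) class. The center is $Z(L)=\{z\in L: zx=0 \text{ for all } x\in L\}$. A subspace $A$ is isotropic if $(u,v)=0$ for all $u,v\in A$. A standard basis of a $10$-dimensional $L$ is a basis $x_{1},y_{1},\ldots,x_{5},y_{5}$ with $(x_i,x_j)=(y_i,y_j)=0$ and $(x_i,y_j)=\delta_{ij}$.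 A nilpotent presentation lists values of the triples $(x_iy_j,y_k)$ and $(y_iy_j,y_k)$ with $1\le i<j<k\le 5$ with respect to a standard basis. By convention, all triple values $(uv,w)$ of basis vectors $u,v,w$ which do not follow from the listed ones by the alternating property are $0$. Such a presentation determines an SAA up to isomorphism. *)

theory Defs
  imports "HOL-Analysis.Analysis"
begin

text \<open>
  The underlying vector space of an algebra is the whole type \<open>'v\<close>, with scalar multiplication
  \<open>scl\<close> over the field \<open>'k\<close>, in the style of the distribution theory of vector spaces. The form is
  \<open>frm\<close> and the algebra product is \<open>prd\<close>.
\<close>

record ('k, 'v) form_algebra =
  scl :: "'k \<Rightarrow> 'v \<Rightarrow> 'v"
  frm :: "'v \<Rightarrow> 'v \<Rightarrow> 'k"
  prd :: "'v \<Rightarrow> 'v \<Rightarrow> 'v"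

text \<open>
  Indices of the vectors of a standard basis: \<open>Xi i\<close> stands for $x_i$ and \<open>Yi i\<close> for $y_i$.
\<close>

datatype basis_index = Xi nat | Yi nat

definition basis_indices :: "nat \<Rightarrow> basis_index set" where
  "basis_indices n = Xi ` {1..n} \<union> Yi ` {1..n}"

text \<open>
  A presentation is the set of its listed values: \<open>(a, b, c, r)\<close> stands for the relation
  $(uv,w) = r$, where $u,v,w$ are the basis vectors with indices \<open>a\<close>, \<open>b\<close>, \<open>c\<close>.
\<close>

type_synonym 'k presentation = "(basis_index \<times> basis_index \<times> basis_index \<times> 'k) set"

definition P10_2_7 :: "'k::field presentation" where
  "P10_2_7 = {(Xi 2, Yi 3, Yi 5, 1), (Xi 3, Yi 4, Yi 5, 1),
              (Xi 1, Yi 2, Yi 4, 1), (Yi 1, Yi 2, Yi 3, 1)}"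

locale symplectic_alternating_algebra =
  vector_space "scl L" for L :: "('k::field, 'v::ab_group_add) form_algebra" +
  assumes finite_dim: "\<exists>B. finite B \<and> span B = UNIV"
    and frm_linear_left: "\<And>y. Vector_Spaces.linear (scl L) (*) (\<lambda>x. frm L x y)"
    and frm_linear_right: "\<And>x. Vector_Spaces.linear (scl L) (*) (\<lambda>y. frm L x y)"
    and frm_alternating: "\<And>x. frm L x x = 0"
    and frm_nondegenerate: "\<And>x. (\<And>y. frm L x y = 0) \<Longrightarrow> x = 0"
    and prd_linear_left: "\<And>y. Vector_Spaces.linear (scl L) (scl L) (\<lambda>x. prd L x y)"
    and prd_linear_right: "\<And>x. Vector_Spaces.linear (scl L) (scl L) (\<lambda>y. prd L x y)"
    and prd_alternating: "\<And>x. prd L x x = 0"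
    and frm_prd_cyclic: "\<And>x y z. frm L (prd L x y) z = frm L (prd L y z) x"
begin

definition subspace_prod :: "'v set \<Rightarrow> 'v set \<Rightarrow> 'v set" where
  "subspace_prod A B = span {prd L a b | a b. a \<in> A \<and> b \<in> B}"

text \<open>\<open>lower_power k\<close> is $L^k$ for \<open>k \<ge> 1\<close>; the value at \<open>0\<close> is a dummy.\<close>

fun lower_power :: "nat \<Rightarrow> 'v set" where
  "lower_power 0 = UNIV"
| "lower_power (Suc 0) = UNIV"
| "lower_power (Suc (Suc k)) = subspace_prod (lower_power (Suc k)) UNIV"

definition nilpotent :: bool where
  "nilpotent \<longleftrightarrow> (\<exists>k. lower_power (k + 1) = {0})"

definition nilpotence_class :: nat where
  "nilpotence_class = (LEAST k. lower_power (k + 1) = {0})"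

definition center :: "'v set" where
  "center = {z. \<forall>x. prd L z x = 0}"

definition isotropic :: "'v set \<Rightarrow> bool" where
  "isotropic A \<longleftrightarrow> (\<forall>u\<in>A. \<forall>v\<in>A. frm L u v = 0)"

definition type_10_2_7 :: bool where
  "type_10_2_7 \<longleftrightarrow>
     dim UNIV = 10 \<and> nilpotent \<and>
     isotropic center \<and> dim center = 2 \<and>
     nilpotence_class = 7 \<and>
     subspace_prod (lower_power 4) (lower_power 3) \<noteq> lower_power 7 \<and>
     \<not> subspace_prod (lower_power 5) (lower_power 2) \<subseteq> subspace_prod (lower_power 4) (lower_power 3)"

definition standard_basis :: "nat \<Rightarrow> (basis_index \<Rightarrow> 'v) \<Rightarrow> bool" where
  "standard_basis n b \<longleftrightarrow>
     inj_on b (basis_indices n) \<and>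
     independent (b ` basis_indices n) \<and> span (b ` basis_indices n) = UNIV \<and>
     (\<forall>i\<in>{1..n}. \<forall>j\<in>{1..n}.
        frm L (b (Xi i)) (b (Xi j)) = 0 \<and>
        frm L (b (Yi i)) (b (Yi j)) = 0 \<and>
        frm L (b (Xi i)) (b (Yi j)) = (if i = j then 1 else 0))"

text \<open>
  By the alternating property a listed triple determines exactly the values of the triples with
  the same underlying set of indices, and triples with a repeated index have value 0. Hence the
  convention on the triples that do not follow from the listed ones is the last conjunct.
\<close>

definition has_presentation :: "nat \<Rightarrow> 'k presentation \<Rightarrow> bool" where
  "has_presentation n P \<longleftrightarrow>
     (\<exists>b. standard_basis n b \<and>
        (\<forall>(i, j, k, r)\<in>P. frm L (prd L (b i) (b j)) (b k) = r) \<and>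
        (\<forall>i\<in>basis_indices n. \<forall>j\<in>basis_indices n. \<forall>k\<in>basis_indices n.
           (\<forall>(i', j', k', r)\<in>P. {i, j, k} \<noteq> {i', j', k'}) \<longrightarrow>
           frm L (prd L (b i) (b j)) (b k) = 0))"

end

definition saa_isomorphic ::
  "('k::field, 'v::ab_group_add) form_algebra \<Rightarrow> ('k, 'w::ab_group_add) form_algebra \<Rightarrow> bool" where
  "saa_isomorphic L M \<longleftrightarrow>
     (\<exists>f. Vector_Spaces.linear (scl L) (scl M) f \<and> bij f \<and>
        (\<forall>x y. f (prd L x y) = prd M (f x) (f y)) \<and>
        (\<forall>x y. frm M (f x) (f y) = frm L x y))"

end

theory Submission
  imports Defs
begin

text \<open>
  The form pairs $L^i$ with $L^j$ trivially as soon as $i + j \geq 9$, and $L^i L^j = 0$ for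
  $i + j \geq 8$. Comparing dimensions with this duality forces
  $\dim L^k = 10, 8, 7, 6, 4, 3, 2$ for $k = 1, \ldots, 7$ and $L^{9-k} = (L^k)^\perp$ for
  $2 \leq k \leq 7$. Hence $L$ is generated by two elements $a, b$ modulo $L^2$, and with
  $u = ab$, $v = ub$ the higher powers are spanned by products of $a, b, u, v$; the two inequalities
  between products of powers amount to $vu \notin L^5$ and $(va, vu) \neq 0$. Replacing $a$ and $b$
  by suitable generators gives $ua = vb = 0$, $(va, vu) = -1$ and $(a, b) = 0$. Then
  $y_5 = b$, $y_4 = a$, $y_3 = -u$, $y_2 = v$, $y_1 = -va$, $x_1 = -vu$, $x_2 = -x_1 y_4$,
  $x_3 = y_1 y_2$, $x_4 = x_1 y_2$, $x_5 = x_2 y_3$ is a standard basis with the stated triple values,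
  because a triple with two entries in $L^4$ vanishes and the products of $y_2, \ldots, y_5$ are known.
\<close>

text \<open>A space of products is located by its pairings with a, b and L^2. For x in L^4, y in
  L^3, z in L^2 one has (xy, z) = (yz, x), where yz lies in F vu + L^5 and L^5 is orthogonal to L^4;
  so vu in L^5 would push L^4 L^3 into the complement of L^2, which is L^7. Likewise L^5 L^2 always
  lies in the line of vectors orthogonal to a and L^2, and (va, vu) = 0 would make (vu)v, an element
  of L^4 L^3, span that line. Consequently va and vu form a basis of L^4 modulo L^5, a plane on
  which the form is non-degenerate. The corrections of a that clear ua solve linear equations with
  leading coefficient k = (va, vu) up to sign, and k becomes -1 by rescaling a and b with k and its
  inverse. No root is ever extracted, so one normal form serves every field. The converse grades the
  basis by weights and separates x_5 from L^4 L^3 by pairing with y_5. Uniqueness holds because the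
  presentation fixes every triple of basis vectors. For existence, a sum of four coordinate
  determinants on F^10 serves as the trilinear form.\<close>

context symplectic_alternating_algebra
begin

abbreviation form :: "'v \<Rightarrow> 'v \<Rightarrow> 'k"  ("\<lparr>_, _\<rparr>") where
  "\<lparr>x, y\<rparr> \<equiv> frm L x y"

abbreviation product :: "'v \<Rightarrow> 'v \<Rightarrow> 'v"  (infixl "\<cdot>" 75) where
  "x \<cdot> y \<equiv> prd L x y"

abbreviation scalar :: "'k \<Rightarrow> 'v \<Rightarrow> 'v"  (infixr "\<star>" 72) where
  "c \<star> x \<equiv> scl L c x"

subsection \<open>Linear algebra of the form\<close>

lemma frm_simps [simp]:
  "\<lparr>x + y, z\<rparr> = \<lparr>x, z\<rparr> + \<lparr>y, z\<rparr>" "\<lparr>x, y + z\<rparr> = \<lparr>x, y\<rparr> + \<lparr>x, z\<rparr>"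
  "\<lparr>x - y, z\<rparr> = \<lparr>x, z\<rparr> - \<lparr>y, z\<rparr>" "\<lparr>x, y - z\<rparr> = \<lparr>x, y\<rparr> - \<lparr>x, z\<rparr>"
  "\<lparr>c \<star> x, z\<rparr> = c * \<lparr>x, z\<rparr>" "\<lparr>x, c \<star> z\<rparr> = c * \<lparr>x, z\<rparr>"
  "\<lparr>- x, z\<rparr> = - \<lparr>x, z\<rparr>" "\<lparr>x, - z\<rparr> = - \<lparr>x, z\<rparr>"
  "\<lparr>0, z\<rparr> = 0" "\<lparr>x, 0\<rparr> = 0"
proof -
  interpret l: Vector_Spaces.linear "scl L" "(*)" "\<lambda>x. \<lparr>x, z\<rparr>" by (rule frm_linear_left)
  interpret r: Vector_Spaces.linear "scl L" "(*)" "\<lambda>y. \<lparr>x, y\<rparr>" by (rule frm_linear_right)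
  show "\<lparr>x + y, z\<rparr> = \<lparr>x, z\<rparr> + \<lparr>y, z\<rparr>" "\<lparr>x, y + z\<rparr> = \<lparr>x, y\<rparr> + \<lparr>x, z\<rparr>"
    "\<lparr>x - y, z\<rparr> = \<lparr>x, z\<rparr> - \<lparr>y, z\<rparr>" "\<lparr>x, y - z\<rparr> = \<lparr>x, y\<rparr> - \<lparr>x, z\<rparr>"
    "\<lparr>c \<star> x, z\<rparr> = c * \<lparr>x, z\<rparr>" "\<lparr>x, c \<star> z\<rparr> = c * \<lparr>x, z\<rparr>"
    "\<lparr>- x, z\<rparr> = - \<lparr>x, z\<rparr>" "\<lparr>x, - z\<rparr> = - \<lparr>x, z\<rparr>"
    "\<lparr>0, z\<rparr> = 0" "\<lparr>x, 0\<rparr> = 0"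
    by (rule l.add r.add l.diff r.diff l.scale r.scale l.neg r.neg l.zero r.zero)+
qed

lemma prd_simps [simp]:
  "(x + y) \<cdot> z = x \<cdot> z + y \<cdot> z" "x \<cdot> (y + z) = x \<cdot> y + x \<cdot> z"
  "(x - y) \<cdot> z = x \<cdot> z - y \<cdot> z" "x \<cdot> (y - z) = x \<cdot> y - x \<cdot> z"
  "(c \<star> x) \<cdot> z = c \<star> (x \<cdot> z)" "x \<cdot> (c \<star> z) = c \<star> (x \<cdot> z)"
  "(- x) \<cdot> z = - (x \<cdot> z)" "x \<cdot> (- z) = - (x \<cdot> z)"
  "0 \<cdot> z = 0" "x \<cdot> 0 = 0"
proof -
  interpret l: Vector_Spaces.linear "scl L" "scl L" "\<lambda>x. x \<cdot> z" by (rule prd_linear_left)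
  interpret r: Vector_Spaces.linear "scl L" "scl L" "\<lambda>y. x \<cdot> y" by (rule prd_linear_right)
  show "(x + y) \<cdot> z = x \<cdot> z + y \<cdot> z" "x \<cdot> (y + z) = x \<cdot> y + x \<cdot> z"
    "(x - y) \<cdot> z = x \<cdot> z - y \<cdot> z" "x \<cdot> (y - z) = x \<cdot> y - x \<cdot> z"
    "(c \<star> x) \<cdot> z = c \<star> (x \<cdot> z)" "x \<cdot> (c \<star> z) = c \<star> (x \<cdot> z)"
    "(- x) \<cdot> z = - (x \<cdot> z)" "x \<cdot> (- z) = - (x \<cdot> z)"
    "0 \<cdot> z = 0" "x \<cdot> 0 = 0"
    by (rule l.add r.add l.diff r.diff l.scale r.scale l.neg r.neg l.zero r.zero)+
qed

lemma frm_sum [simp]: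
  "\<lparr>sum f A, z\<rparr> = (\<Sum>i\<in>A. \<lparr>f i, z\<rparr>)" "\<lparr>z, sum f A\<rparr> = (\<Sum>i\<in>A. \<lparr>z, f i\<rparr>)"
  by (induction A rule: infinite_finite_induct) auto

declare frm_alternating [simp] prd_alternating [simp]

lemma frm_commute: "\<lparr>x, y\<rparr> = - \<lparr>y, x\<rparr>"
proof -
  have "\<lparr>x, y\<rparr> + \<lparr>y, x\<rparr> = \<lparr>x + y, x + y\<rparr>" by (simp only: frm_simps) simp
  also have "\<dots> = 0" by (rule frm_alternating)
  finally show ?thesis by (simp add: eq_neg_iff_add_eq_0)
qed

lemma frm_eq_0_commute: "\<lparr>x, y\<rparr> = 0 \<longleftrightarrow> \<lparr>y, x\<rparr> = 0"
  using frm_commute[of x y] by simp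

lemma frm_eq_0_sym: "\<lparr>x, y\<rparr> = 0 \<Longrightarrow> \<lparr>y, x\<rparr> = 0"
  using frm_commute[of y x] by simp

lemma prd_commute: "x \<cdot> y = - (y \<cdot> x)"
proof -
  have "x \<cdot> y + y \<cdot> x = (x + y) \<cdot> (x + y)" by (simp only: prd_simps) simp
  also have "\<dots> = 0" by (rule prd_alternating)
  finally show ?thesis by (simp add: eq_neg_iff_add_eq_0)
qed

lemma frm_prd_swap: "\<lparr>x \<cdot> y, z\<rparr> = - \<lparr>x \<cdot> z, y\<rparr>"
  using frm_prd_cyclic[of z x y] prd_commute[of x z] by simp

text \<open>Rotation turns a repeated entry into a square: (xy, x) = (xx, y) and (xy, y) = (yy,
  x).\<close>

lemma frm_prd_eq_0 [simp]: "\<lparr>x \<cdot> y, x\<rparr> = 0" "\<lparr>x \<cdot> y, y\<rparr> = 0"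
  "\<lparr>x, x \<cdot> y\<rparr> = 0" "\<lparr>y, x \<cdot> y\<rparr> = 0"
proof -
  show *: "\<lparr>x \<cdot> y, x\<rparr> = 0" "\<lparr>x \<cdot> y, y\<rparr> = 0" for x y
    using frm_prd_cyclic[of x x y] frm_prd_cyclic[of x y y] frm_prd_cyclic[of y x x] by auto
  show "\<lparr>x, x \<cdot> y\<rparr> = 0" "\<lparr>y, x \<cdot> y\<rparr> = 0" by (rule frm_eq_0_sym, rule *)+
qed

lemma frm_nondegenerate_right: "(\<And>x. \<lparr>x, y\<rparr> = 0) \<Longrightarrow> y = 0"
  using frm_nondegenerate[of y] by (auto simp: frm_eq_0_commute[of y])

lemma frm_ext: "(\<And>z. \<lparr>x, z\<rparr> = \<lparr>y, z\<rparr>) \<Longrightarrow> x = y"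
  using frm_nondegenerate[of "x - y"] by simp

lemma subspace_orthogonal: "subspace {x. \<lparr>x, y\<rparr> = 0}" "subspace {x. \<lparr>y, x\<rparr> = 0}"
  by (auto simp: subspace_def)

lemma frm_eq_0_span: "x \<in> span S \<Longrightarrow> (\<And>s. s \<in> S \<Longrightarrow> \<lparr>s, y\<rparr> = 0) \<Longrightarrow> \<lparr>x, y\<rparr> = 0"
  using span_minimal[OF _ subspace_orthogonal(1), of S y] by auto

text \<open>The locale of finite-dimensional spaces has a basis among its parameters, so one is
  fixed by choice.\<close>

definition fin_basis :: "'v set" where
  "fin_basis = (SOME B. finite B \<and> independent B \<and> span B = UNIV)"

lemma fin_basis: "finite fin_basis" "independent fin_basis" "span fin_basis = UNIV"
proof -
  obtain S where S: "finite S" "span S = UNIV" using finite_dim by auto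
  obtain B where B: "B \<subseteq> S" "independent B" "S \<subseteq> span B"
    using maximal_independent_subset[of S] by auto
  have "finite B \<and> independent B \<and> span B = UNIV"
    using B S finite_subset span_minimal[OF B(3) subspace_span] by auto
  then have "finite fin_basis \<and> independent fin_basis \<and> span fin_basis = UNIV"
    unfolding fin_basis_def by (rule someI)
  then show "finite fin_basis" "independent fin_basis" "span fin_basis = UNIV" by auto
qed

end

sublocale symplectic_alternating_algebra \<subseteq> finite_dimensional_vector_space "scl L" fin_basis
  by unfold_locales (fact fin_basis)+

context symplectic_alternating_algebra
begin

declare dim_UNIV [simp del]

text \<open>Pairing a vanishing combination with \<open>d j\<close> leaves only the coefficient at
  \<open>j\<close>.\<close>

lemma dual_family_independent:
  assumes "finite I" and dual: "\<And>i j. i \<in> I \<Longrightarrow> j \<in> I \<Longrightarrow> \<lparr>b i, d j\<rparr> = (if i = j then 1 else 0)"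
  shows "inj_on b I" "independent (b ` I)"
proof -
  show inj: "inj_on b I"
  proof (rule inj_onI)
    fix i j assume ij: "i \<in> I" "j \<in> I" "b i = b j"
    then have "(if j = i then 1 else 0 :: 'k) = 1" using dual[OF ij(1,1)] dual[OF ij(2,1)] by simp
    then show "i = j" by (simp split: if_splits)
  qed
  show "independent (b ` I)"
    unfolding independent_explicit
  proof (intro conjI allI impI ballI)
    show "finite (b ` I)" using assms by simp
    fix c v assume s: "(\<Sum>v\<in>b ` I. c v \<star> v) = 0" and "v \<in> b ` I"
    then obtain j where j: "j \<in> I" "v = b j" by auto
    have "0 = \<lparr>\<Sum>i\<in>I. c (b i) \<star> b i, d j\<rparr>" using s by (simp add: sum.reindex[OF inj])
    also have "\<dots> = (\<Sum>i\<in>I. c (b i) * (if i = j then 1 else 0))"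
      using j dual by (simp cong: sum.cong)
    also have "\<dots> = (\<Sum>i\<in>I. if i = j then c (b i) else 0)"
      by (rule sum.cong) auto
    also have "\<dots> = c (b j)" using j \<open>finite I\<close> by simp
    finally show "c v = 0" using j by simp
  qed
qed

text \<open>The map sending x to the sum of (x, b) b over the basis is injective by non-degeneracy,
  hence surjective in finite dimension; preimages of the basis vectors form the dual family.\<close>

lemma dual_family_exists:
  assumes "independent B" "span B = UNIV"
  obtains d where "\<And>b b'. b \<in> B \<Longrightarrow> b' \<in> B \<Longrightarrow> \<lparr>d b, b'\<rparr> = (if b = b' then 1 else 0)"
proof -
  have fin: "finite B" using assms(1) by (rule finiteI_independent)
  define \<phi> where "\<phi> x = (\<Sum>b\<in>B. \<lparr>x, b\<rparr> \<star> b)" for x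
  have coeff: "\<lparr>x, b\<rparr> = c b" if "\<phi> x = (\<Sum>b\<in>B. c b \<star> b)" "b \<in> B" for x b c
  proof -
    have "(\<Sum>b\<in>B. (\<lparr>x, b\<rparr> - c b) \<star> b) = 0"
      using that(1) by (simp add: \<phi>_def scale_left_diff_distrib sum_subtractf)
    then show ?thesis
      using independentD[OF assms(1) fin order_refl, of "\<lambda>b. \<lparr>x, b\<rparr> - c b" b] that(2) by simp
  qed
  have lin: "Vector_Spaces.linear (scl L) (scl L) \<phi>"
    unfolding Vector_Spaces.linear_iff
    by (simp add: vector_space_axioms \<phi>_def scale_left_distrib sum.distrib scale_sum_right)
  interpret l: Vector_Spaces.linear "scl L" "scl L" \<phi> by (rule lin)
  have "x = 0" if "\<phi> x = 0" for x
  proof (rule frm_nondegenerate)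
    fix y
    have "\<lparr>x, b\<rparr> = 0" if "b \<in> B" for b
      using coeff[of x "\<lambda>_. 0" b] that \<open>\<phi> x = 0\<close> by simp
    then have "\<lparr>b, x\<rparr> = 0" if "b \<in> B" for b using that frm_eq_0_sym by blast
    then have "\<lparr>y, x\<rparr> = 0" using assms(2) frm_eq_0_span[of y B x] by blast
    then show "\<lparr>x, y\<rparr> = 0" by (rule frm_eq_0_sym)
  qed
  then have "inj \<phi>" by (simp add: l.inj_iff_eq_0)
  then have "surj \<phi>" using lin linear_inj_imp_surj by blast
  then have "\<forall>b. \<exists>x. \<phi> x = b" by (metis surjD)
  then obtain d where d: "\<And>b. \<phi> (d b) = b" by metis
  show ?thesis
  proof (rule that)
    fix b b' assume b: "b \<in> B" "b' \<in> B"
    have "\<phi> (d b) = (\<Sum>b'\<in>B. (if b = b' then 1 else 0) \<star> b')"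
    proof -
      have "(\<Sum>b'\<in>B. (if b = b' then 1 else 0) \<star> b') = (\<Sum>b'\<in>B. if b = b' then b' else 0)"
        by (rule sum.cong) auto
      then show ?thesis using b fin by (simp add: d)
    qed
    then show "\<lparr>d b, b'\<rparr> = (if b = b' then 1 else 0)" by (rule coeff) (fact b(2))
  qed
qed

definition perp :: "'v set \<Rightarrow> 'v set" where
  "perp W = {x. \<forall>w\<in>W. \<lparr>x, w\<rparr> = 0}"

lemma subspace_perp: "subspace (perp W)"
  by (auto simp: perp_def subspace_def)

text \<open>Extend a basis C of W to a basis B of the whole space. The vectors dual to B - C are a
  basis of the complement: they annihilate C, and an x orthogonal to W has no components along the
  duals of C.\<close>

lemma dim_perp:
  assumes "subspace W"
  shows "dim W + dim (perp W) = dim UNIV"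
proof -
  obtain C where C: "C \<subseteq> W" "independent C" "span C = W" "card C = dim W"
    using basis_subspace_exists[OF assms] by metis
  obtain B where B: "C \<subseteq> B" "independent B" "UNIV \<subseteq> span B"
    using maximal_independent_subset_extend[of C UNIV] C(2) by auto
  have sB: "span B = UNIV" using B(3) by auto
  have fin: "finite B" using B(2) by (rule finiteI_independent)
  obtain d where d: "\<And>b b'. b \<in> B \<Longrightarrow> b' \<in> B \<Longrightarrow> \<lparr>d b, b'\<rparr> = (if b = b' then 1 else 0)"
    using dual_family_exists[OF B(2) sB] by metis
  have ind: "inj_on d (B - C)" "independent (d ` (B - C))"
    using dual_family_independent[of "B - C" d "\<lambda>b. b"] d fin by auto
  have sub: "d ` (B - C) \<subseteq> perp W"
  proof clarify
    fix b assume b: "b \<in> B" "b \<notin> C"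
    have "\<lparr>w, d b\<rparr> = 0" if "w \<in> span C" for w
      using that
    proof (rule frm_eq_0_span)
      fix s assume "s \<in> C"
      then have "\<lparr>d b, s\<rparr> = 0" using d[of b s] b B(1) by auto
      then show "\<lparr>s, d b\<rparr> = 0" by (rule frm_eq_0_sym)
    qed
    then show "d b \<in> perp W"
      using C(3) frm_eq_0_commute[of "d b"] by (auto simp: perp_def)
  qed
  have "perp W \<subseteq> span (d ` (B - C))"
  proof
    fix x assume x: "x \<in> perp W"
    have "\<lparr>b, x - (\<Sum>b\<in>B. \<lparr>x, b\<rparr> \<star> d b)\<rparr> = 0" if b: "b \<in> B" for b
    proof -
      have "\<lparr>\<Sum>b\<in>B. \<lparr>x, b\<rparr> \<star> d b, b\<rparr> = (\<Sum>b'\<in>B. if b' = b then \<lparr>x, b'\<rparr> else 0)"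
        using d b by (auto intro!: sum.cong)
      then have "\<lparr>x - (\<Sum>b\<in>B. \<lparr>x, b\<rparr> \<star> d b), b\<rparr> = 0"
        using fin b by simp
      then show ?thesis by (rule frm_eq_0_sym)
    qed
    then have "\<lparr>y, x - (\<Sum>b\<in>B. \<lparr>x, b\<rparr> \<star> d b)\<rparr> = 0" for y
      using sB frm_eq_0_span[of y B] by blast
    then have "x = (\<Sum>b\<in>B. \<lparr>x, b\<rparr> \<star> d b)"
      using frm_nondegenerate_right by fastforce
    also have "\<dots> = (\<Sum>b\<in>B - C. \<lparr>x, b\<rparr> \<star> d b)"
      using x C(1) fin by (intro sum.mono_neutral_right) (auto simp: perp_def)
    also have "\<dots> \<in> span (d ` (B - C))"
      by (intro span_sum span_scale span_base) auto
    finally show "x \<in> span (d ` (B - C))" .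
  qed
  then have "card (d ` (B - C)) = dim (perp W)"
    using basis_card_eq_dim sub ind(2) by blast
  moreover have "card (d ` (B - C)) = card B - card C"
    using ind(1) fin B(1) by (simp add: card_image card_Diff_subset finite_subset)
  moreover have "card B = dim UNIV" using basis_card_eq_dim[of B UNIV] B by auto
  moreover have "card C \<le> card B" using fin B(1) by (rule card_mono)
  ultimately show ?thesis using C(4) by linarith
qed

lemma subspace_codim1:
  assumes "subspace S" "subspace T" "S \<subseteq> T" "dim T \<le> dim S + 1" "v \<in> T" "v \<notin> S" "x \<in> T"
  obtains c where "x - c \<star> v \<in> S"
proof -
  have sS: "span S = S" using assms(1) by (simp add: span_eq_iff)
  have "dim (span (insert v S)) = dim S + 1" using assms(6) by (simp add: dim_insert sS)
  moreover have "span (insert v S) \<subseteq> T" using assms by (intro span_minimal) auto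
  ultimately have "span (insert v S) = T"
    using subspace_dim_equal[of "span (insert v S)" T] assms(2,4) by simp
  then show ?thesis using assms(7) span_breakdown_eq[of x v S] sS that by auto
qed

lemma subspace_codim2:
  assumes "subspace S" "subspace T" "S \<subseteq> T" "dim T \<le> dim S + 2" "p \<in> T" "q \<in> T"
    and "p \<notin> S" "\<And>c. q - c \<star> p \<notin> S" "x \<in> T"
  obtains c d where "x - (c \<star> p + d \<star> q) \<in> S"
proof -
  have sS: "span S = S" using assms(1) by (simp add: span_eq_iff)
  let ?S = "span (insert p S)"
  have "dim ?S = dim S + 1" using assms(7) by (simp add: dim_insert sS)
  moreover have "?S \<subseteq> T" using assms by (intro span_minimal) auto
  moreover have "q \<notin> ?S" using assms(8) span_breakdown_eq[of q p S] sS by auto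
  ultimately obtain d where "x - d \<star> q \<in> ?S"
    using subspace_codim1[of ?S T q x] assms by auto
  then obtain c where "x - d \<star> q - c \<star> p \<in> S"
    using span_breakdown_eq[of _ p S] sS by auto
  then show ?thesis using that[of c d] by (simp add: algebra_simps)
qed

lemma subspace_complement2:
  assumes "subspace S" "dim UNIV = dim S + 2"
  obtains p q where "\<And>x. \<exists>c d. x - (c \<star> p + d \<star> q) \<in> S"
proof -
  have sS: "span S = S" using assms(1) by (simp add: span_eq_iff)
  have "S \<noteq> UNIV" using assms(2) by auto
  then obtain p where p: "p \<notin> S" by auto
  let ?S = "span (insert p S)"
  have "dim ?S = dim S + 1" using p by (simp add: dim_insert sS)
  then have "dim ?S \<noteq> dim UNIV" using assms(2) by linarith
  then have "?S \<noteq> UNIV" by metis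
  then obtain q where q: "q \<notin> ?S" by auto
  have "\<exists>c d. x - (c \<star> p + d \<star> q) \<in> S" for x
  proof -
    have "q - c \<star> p \<notin> S" for c using q span_breakdown_eq[of q p S] sS by auto
    then show ?thesis
      using subspace_codim2[OF assms(1) subspace_UNIV _ _ _ _ p, of q x] assms(2)
      by (metis UNIV_I order_refl subset_UNIV)
  qed
  then show ?thesis by (rule that)
qed

subsection \<open>The lower central series\<close>

abbreviation lower_power_syn :: "nat \<Rightarrow> 'v set"  ("U") where "U k \<equiv> lower_power k"

lemma subspace_U: "subspace (U k)"
  by (induction k rule: lower_power.induct) (auto simp: subspace_prod_def)

lemma U_Suc: "1 \<le> k \<Longrightarrow> U (Suc k) = subspace_prod (U k) UNIV"
  by (cases k) auto

lemmas U_closed = subspace_add[OF subspace_U] subspace_diff[OF subspace_U]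
  subspace_neg[OF subspace_U] subspace_scale[OF subspace_U] subspace_0[OF subspace_U]

lemma prd_in_U:
  assumes "1 \<le> k" "x \<in> U k"
  shows "x \<cdot> y \<in> U (Suc k)" "y \<cdot> x \<in> U (Suc k)"
proof -
  show "x \<cdot> y \<in> U (Suc k)"
    unfolding U_Suc[OF assms(1)] subspace_prod_def using assms(2) by (intro span_base) auto
  then show "y \<cdot> x \<in> U (Suc k)" using prd_commute[of y x] U_closed(3) by simp
qed

lemma U_Suc_least:
  assumes "1 \<le> k" "subspace S" "\<And>a b. a \<in> U k \<Longrightarrow> a \<cdot> b \<in> S"
  shows "U (Suc k) \<subseteq> S"
  unfolding U_Suc[OF assms(1)] subspace_prod_def
  using assms(2,3) by (intro span_minimal) auto

lemma U_Suc_subset: "U (Suc k) \<subseteq> U k"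
proof (induction k)
  case (Suc k)
  show ?case
  proof (cases k)
    case (Suc m)
    show ?thesis
    proof (rule U_Suc_least)
      fix a b assume "a \<in> U (Suc k)"
      then have "a \<in> U k" using Suc.IH by blast
      then show "a \<cdot> b \<in> U (Suc k)" using Suc by (intro prd_in_U(1)) simp_all
    qed (simp_all add: subspace_U del: lower_power.simps)
  qed simp
qed simp

lemma U_antimono: "i \<le> j \<Longrightarrow> U j \<subseteq> U i"
  by (rule lift_Suc_antimono_le[of U]) (rule U_Suc_subset)

text \<open>By cyclicity (zx, y) = (xy, z): that z annihilates everything and that z is orthogonal
  to all products are the same condition.\<close>

lemma center_eq_perp: "center = perp (U 2)"
proof (rule antisym; rule subsetI)
  fix z assume z: "z \<in> center"
  have "U (Suc 1) \<subseteq> {w. \<lparr>z, w\<rparr> = 0}"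
  proof (rule U_Suc_least)
    fix x y
    have "\<lparr>z, x \<cdot> y\<rparr> = 0"
      using z frm_prd_cyclic[of z x y] frm_commute[of z "x \<cdot> y"] by (simp add: center_def)
    then show "x \<cdot> y \<in> {w. \<lparr>z, w\<rparr> = 0}" by simp
  qed (simp_all add: subspace_orthogonal)
  then show "z \<in> perp (U 2)" by (auto simp: perp_def numeral_2_eq_2)
next
  fix z assume z: "z \<in> perp (U 2)"
  have "\<lparr>z \<cdot> x, y\<rparr> = 0" for x y
  proof -
    have "x \<cdot> y \<in> U 2" using prd_in_U(1)[of 1 x y] by (simp add: numeral_2_eq_2)
    then show ?thesis using z frm_prd_cyclic[of z x y] frm_commute[of z "x \<cdot> y"]
      by (auto simp: perp_def)
  qed
  then show "z \<in> center" by (auto simp: center_def intro: frm_nondegenerate)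
qed

text \<open>The identity (ab, y) = (by, a) moves a factor from the left entry to the right one and
  keeps i + j. At i = 1 the right entry lies in \<open>U (Suc n)\<close>, which is zero.\<close>

lemma U_orthogonal:
  assumes "U (Suc n) = {0}" "1 \<le> i" "1 \<le> j" "n + 2 \<le> i + j" "x \<in> U i" "y \<in> U j"
  shows "\<lparr>x, y\<rparr> = 0"
  using assms(2-6)
proof (induction i arbitrary: j x y rule: dec_induct)
  case base
  then have "U j \<subseteq> U (Suc n)" by (intro U_antimono) auto
  then show ?case using base assms(1) by auto
next
  case (step i)
  have "U (Suc i) \<subseteq> {x. \<lparr>x, y\<rparr> = 0}"
  proof (rule U_Suc_least)
    fix a b assume "a \<in> U i"
    then have "\<lparr>a, b \<cdot> y\<rparr> = 0"
      using step.prems prd_in_U(2)[of j y b] by (intro step.IH[of "Suc j"]) auto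
    then show "a \<cdot> b \<in> {x. \<lparr>x, y\<rparr> = 0}"
      using frm_prd_cyclic[of a b y] frm_commute[of a] by simp
  qed (use step.hyps in \<open>simp_all add: subspace_orthogonal\<close>)
  then show ?case using step.prems by auto
qed

text \<open>The bound is one lower than for orthogonality, because (xy, z) is up to sign (x, yz) and
  yz lies one power deeper than y.\<close>

lemma U_prd_eq_0:
  assumes "U (Suc n) = {0}" "1 \<le> i" "1 \<le> j" "n + 1 \<le> i + j" "x \<in> U i" "y \<in> U j"
  shows "x \<cdot> y = 0"
proof (rule frm_nondegenerate)
  fix z
  have "\<lparr>x, y \<cdot> z\<rparr> = 0"
    using U_orthogonal[OF assms(1), of i "Suc j" x "y \<cdot> z"] assms prd_in_U(1)[of j y z] by simp
  then show "\<lparr>x \<cdot> y, z\<rparr> = 0" using frm_prd_cyclic[of x y z] frm_commute[of x] by simp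
qed

lemma prd_in: "x \<in> U k \<Longrightarrow> 1 \<le> k \<Longrightarrow> l \<le> Suc k \<Longrightarrow> x \<cdot> y \<in> U l"
  "x \<in> U k \<Longrightarrow> 1 \<le> k \<Longrightarrow> l \<le> Suc k \<Longrightarrow> y \<cdot> x \<in> U l"
  using prd_in_U[of k x y] U_antimono[of l "Suc k"] by blast+

lemma U_mono: "x \<in> U k \<Longrightarrow> l \<le> k \<Longrightarrow> x \<in> U l"
  using U_antimono by blast

end

subsection \<open>Dimensions and duality of the lower powers\<close>

locale saa_10_2_7 = symplectic_alternating_algebra +
  assumes type_10_2_7: type_10_2_7
begin

lemma dim_UNIV_eq: "dim UNIV = 10"
  using type_10_2_7 unfolding type_10_2_7_def by blast

lemma U8: "U 8 = {0}" and U7: "U 7 \<noteq> {0}"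
proof -
  have nil: "nilpotent" and cls: "nilpotence_class = 7"
    using type_10_2_7 unfolding type_10_2_7_def by blast+
  obtain k where k: "U (k + 1) = {0}" using nil unfolding nilpotent_def by (rule exE)
  have c: "(LEAST k. U (k + 1) = {0}) = 7" using cls unfolding nilpotence_class_def .
  have "U ((LEAST k. U (k + 1) = {0}) + 1) = {0}" using k by (rule LeastI)
  then have "U (7 + 1) = {0}" unfolding c .
  then show "U 8 = {0}" by simp
  have "6 < (LEAST k. U (k + 1) = {0})" unfolding c by simp
  then have "U (6 + 1) \<noteq> {0}" by (rule not_less_Least)
  then show "U 7 \<noteq> {0}" by simp
qed

lemma U_eq_0:
  assumes "8 \<le> k" "x \<in> U k" shows "x = 0"
proof -
  have "x \<in> U 8" using assms(2) U_antimono[OF assms(1)] by (rule subsetD[rotated])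
  then show ?thesis unfolding U8 by (rule singletonD)
qed

lemma U_orth: "x \<in> U i \<Longrightarrow> y \<in> U j \<Longrightarrow> 1 \<le> i \<Longrightarrow> 1 \<le> j \<Longrightarrow> 9 \<le> i + j \<Longrightarrow> \<lparr>x, y\<rparr> = 0"
  using U_orthogonal[of 7 i j x y] U8 by simp

lemma U_null: "x \<in> U i \<Longrightarrow> y \<in> U j \<Longrightarrow> 1 \<le> i \<Longrightarrow> 1 \<le> j \<Longrightarrow> 8 \<le> i + j \<Longrightarrow> x \<cdot> y = 0"
  using U_prd_eq_0[of 7 i j x y] U8 by simp

text \<open>Each power depends only on its predecessor, so one repetition makes the series constant
  from there on, while \<open>U 7\<close> and \<open>U 8\<close> differ.\<close>

lemma U_Suc_neq:
  assumes "1 \<le> k" "k \<le> 7" shows "U (Suc k) \<noteq> U k"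
proof
  assume eq: "U (Suc k) = U k"
  have const: "U j = U k" if "k \<le> j" for j
    using that
  proof (induction j rule: dec_induct)
    case (step j)
    have "U (Suc j) = subspace_prod (U j) UNIV" using assms step.hyps by (intro U_Suc) simp
    also have "\<dots> = U (Suc k)" using U_Suc[OF assms(1)] step.IH by simp
    finally show ?case using eq by simp
  qed simp
  have "U 8 = U k" "U 7 = U k" by (rule const; use assms in linarith)+
  then show False using U8 U7 by simp
qed

lemma dim_U_Suc_less: "1 \<le> k \<Longrightarrow> k \<le> 7 \<Longrightarrow> dim (U (Suc k)) < dim (U k)"
proof (rule ccontr)
  assume k: "1 \<le> k" "k \<le> 7" and "\<not> dim (U (Suc k)) < dim (U k)"
  then have "U (Suc k) = U k"
    by (intro subspace_dim_equal subspace_U U_Suc_subset) simp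
  then show False using U_Suc_neq k by simp
qed

lemma dim_U2: "dim (U 2) = 8"
proof -
  have "dim (perp (U 2)) = 2"
    using type_10_2_7 unfolding type_10_2_7_def center_eq_perp by blast
  then show ?thesis using dim_perp[OF subspace_U, of 2] dim_UNIV_eq by linarith
qed

definition generates :: "'b \<Rightarrow> 'b \<Rightarrow> bool" where
  "generates a b \<longleftrightarrow> (\<forall>x. \<exists>c d. x - (c \<star> a + d \<star> b) \<in> U 2)"

lemma generatesE:
  assumes "generates a b" obtains c d where "x - (c \<star> a + d \<star> b) \<in> U 2"
  using assms unfolding generates_def by blast

lemma generators_exist: obtains a b where "generates a b"
proof -
  have "dim UNIV = dim (U 2) + 2" using dim_UNIV_eq dim_U2 by linarith
  with subspace_U obtain a b where "\<And>x. \<exists>c d. x - (c \<star> a + d \<star> b) \<in> U 2"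
    by (rule subspace_complement2) blast
  then show ?thesis using that unfolding generates_def by blast
qed

lemma span_U: "span (U k) = U k"
  by (rule span_eq_iff[THEN iffD2]) (rule subspace_U)

lemma span_insert_U: "x \<in> span (insert v (U k)) \<longleftrightarrow> (\<exists>c. x - c \<star> v \<in> U k)"
  unfolding span_breakdown_eq span_U by (rule refl)

lemma span_insert2_U: "x \<in> span (insert v (insert w (U k))) \<longleftrightarrow> (\<exists>c d. x - (c \<star> v + d \<star> w) \<in> U k)"
  unfolding span_breakdown_eq span_U diff_diff_eq by (rule refl)

lemma span_insert3_U: "x \<in> span (insert v (insert w (insert z (U k)))) \<longleftrightarrow>
   (\<exists>c d e. x - (c \<star> v + d \<star> w + e \<star> z) \<in> U k)"
  unfolding span_breakdown_eq span_U diff_diff_eq add.assoc by (rule refl)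

lemma generates_change:
  assumes "generates a b" "a - (c \<star> a' + d \<star> b') \<in> U 2" "b - (e \<star> a' + f \<star> b') \<in> U 2"
  shows "generates a' b'"
proof -
  let ?V = "span (insert a' (insert b' (U 2)))"
  have "a \<in> ?V" "b \<in> ?V" unfolding span_insert2_U using assms(2,3) by blast+
  moreover have "U 2 \<subseteq> ?V" using span_superset[of "insert a' (insert b' (U 2))"] by blast
  ultimately have "span (insert a (insert b (U 2))) \<subseteq> ?V"
    by (intro span_minimal subspace_span) blast
  then have "x \<in> ?V" for x using assms(1) span_insert2_U[of x a b 2] unfolding generates_def by blast
  then show ?thesis unfolding generates_def span_insert2_U by blast
qed

lemma generates_add:
  assumes "generates a b" "w \<in> U 2"
  shows "generates (a + w) b" "generates a (b + w)"
  using assms U_closed(3)[OF assms(2)] U_closed(5)[of 2]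
  by (auto intro: generates_change[of a b 1 "a + w" 0 b 0 1] generates_change[of a b 1 a 0 "b + w" 0 1])

lemma generates_swap: "generates a b \<Longrightarrow> generates b (- a)"
  by (rule generates_change[of a b 0 b "- 1" "- a" 1 0]) (simp_all add: U_closed(5))

lemma generates_add_multiple:
  assumes "generates a b" shows "generates (a + e \<star> b) b" "generates a (b + e \<star> a)"
  using assms generates_change[of a b 1 "a + e \<star> b" "- e" b 0 1]
    generates_change[of a b 1 a 0 "b + e \<star> a" "- e" 1]
  by (simp_all add: U_closed(5))

lemma generates_scale:
  assumes "generates a b" "e \<noteq> 0" "f \<noteq> 0" shows "generates (e \<star> a) (f \<star> b)"
  using assms generates_change[of a b "1 / e" "e \<star> a" 0 "f \<star> b" 0 "1 / f"]
  by (simp add: U_closed(5))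

lemma prd_in_U2: "x \<cdot> y \<in> U 2"
  by (rule prd_in(1)[of _ 1]) simp_all

text \<open>Modulo \<open>U 3\<close> only products of the generators count, and these are multiples
  of ab by alternation; the coefficient is the 2 by 2 determinant of the coordinates.\<close>

lemma U2_modulo_U3:
  assumes g: "generates a b" and x: "x \<in> U 2"
  obtains c where "x - c \<star> (a \<cdot> b) \<in> U 3"
proof -
  have "U (Suc 1) \<subseteq> span (insert (a \<cdot> b) (U 3))"
  proof (rule U_Suc_least)
    fix x y
    obtain c d where w: "x - (c \<star> a + d \<star> b) \<in> U 2" using generatesE[OF g] by metis
    obtain c' d' where w': "y - (c' \<star> a + d' \<star> b) \<in> U 2" using generatesE[OF g] by metis
    have "(x - (c \<star> a + d \<star> b)) \<cdot> y + (c \<star> a + d \<star> b) \<cdot> (y - (c' \<star> a + d' \<star> b)) \<in> U 3"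
      by (rule U_closed(1)[OF prd_in(1)[OF w] prd_in(2)[OF w']]) simp_all
    moreover have "(c \<star> a + d \<star> b) \<cdot> (c' \<star> a + d' \<star> b) = (c * d' - d * c') \<star> (a \<cdot> b)"
      using prd_commute[of b a] by (simp add: scale_left_diff_distrib algebra_simps scale_right_distrib)
    ultimately have "x \<cdot> y - (c * d' - d * c') \<star> (a \<cdot> b) \<in> U 3"
      by (simp only: prd_simps) (simp add: algebra_simps)
    then show "x \<cdot> y \<in> span (insert (a \<cdot> b) (U 3))" unfolding span_insert_U by blast
  qed simp_all
  then have "x \<in> span (insert (a \<cdot> b) (U 3))" using x by (auto simp: numeral_2_eq_2)
  then show ?thesis using that unfolding span_insert_U by blast
qed

lemma generates_eq_0:
  assumes "generates a b" "\<lparr>w, a\<rparr> = 0" "\<lparr>w, b\<rparr> = 0" "\<And>z. z \<in> U 2 \<Longrightarrow> \<lparr>w, z\<rparr> = 0"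
  shows "w = 0"
proof (rule frm_nondegenerate)
  fix x
  obtain c d where "x - (c \<star> a + d \<star> b) \<in> U 2" using generatesE[OF assms(1)] by metis
  then have "\<lparr>w, x - (c \<star> a + d \<star> b)\<rparr> = 0" by (rule assms(4))
  then show "\<lparr>w, x\<rparr> = 0" using assms(2,3) by simp
qed

text \<open>Dimensions are not yet known here, so the complement is produced explicitly. Since
  \<open>U 7\<close> is non-zero, some r in \<open>U 6\<close> is not central; as \<open>U 6\<close>
  and \<open>U 3\<close> are orthogonal, r pairs non-trivially with ab. Then ra and rb lie in
  \<open>U 7\<close> and are, up to scalars, dual to b and a.\<close>

lemma U7_eq_perp: "U 7 = perp (U 2)"
proof (rule antisym)
  show "U 7 \<subseteq> perp (U 2)"
    using U_eq_0[of 8] prd_in(1)[of _ 7 8] by (auto simp: center_eq_perp[symmetric] center_def)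
  obtain a b where g: "generates a b" by (rule generators_exist)
  have "\<not> U 6 \<subseteq> perp (U 2)"
  proof
    assume "U 6 \<subseteq> perp (U 2)"
    then have "U (Suc 6) \<subseteq> {0}"
      by (intro U_Suc_least) (auto simp: center_eq_perp[symmetric] center_def)
    then show False using U7 U_closed(5)[of 7] by auto
  qed
  then obtain r s where r: "r \<in> U 6" and s: "s \<in> U 2" and rs: "\<lparr>r, s\<rparr> \<noteq> 0"
    by (auto simp: perp_def)
  obtain c where "s - c \<star> (a \<cdot> b) \<in> U 3" using U2_modulo_U3[OF g s] .
  then have "\<lparr>r, s - c \<star> (a \<cdot> b)\<rparr> = 0" by (rule U_orth[OF r]) simp_all
  then have "\<lparr>r, a \<cdot> b\<rparr> \<noteq> 0" using rs by auto
  then have rab: "\<lparr>r \<cdot> a, b\<rparr> \<noteq> 0" "\<lparr>r \<cdot> b, a\<rparr> \<noteq> 0"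
    using frm_prd_cyclic[of r a b] frm_commute[of r "a \<cdot> b"] frm_prd_swap[of r b a] by auto
  show "perp (U 2) \<subseteq> U 7"
  proof
    fix z assume z: "z \<in> perp (U 2)"
    \<comment> \<open>By construction w has the same pairings with a and b as z; both are orthogonal
      to \<open>U 2\<close>, so they agree.\<close>
    define w where "w = (\<lparr>z, b\<rparr> / \<lparr>r \<cdot> a, b\<rparr>) \<star> (r \<cdot> a) + (\<lparr>z, a\<rparr> / \<lparr>r \<cdot> b, a\<rparr>) \<star> (r \<cdot> b)"
    have w: "w \<in> U 7" unfolding w_def by (intro U_closed(1,4) prd_in(1)[OF r]) simp_all
    have "z - w = 0"
    proof (rule generates_eq_0[OF g])
      show "\<lparr>z - w, a\<rparr> = 0" "\<lparr>z - w, b\<rparr> = 0" using rab by (simp_all add: w_def)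
      show "\<lparr>z - w, y\<rparr> = 0" if "y \<in> U 2" for y
        using z that U_orth[OF w that] by (simp add: perp_def)
    qed
    then show "z \<in> U 7" using w by simp
  qed
qed

text \<open>The factor shift of \<open>U_orthogonal\<close> as a single step, so that a hypothetical
  orthogonality can be propagated.\<close>

lemma U_orth_shift:
  assumes "1 \<le> i" "1 \<le> j" "\<And>x y. x \<in> U i \<Longrightarrow> y \<in> U (Suc j) \<Longrightarrow> \<lparr>x, y\<rparr> = 0"
    and "x \<in> U (Suc i)" "y \<in> U j"
  shows "\<lparr>x, y\<rparr> = 0"
proof -
  have "U (Suc i) \<subseteq> {x. \<lparr>x, y\<rparr> = 0}"
  proof (rule U_Suc_least)
    fix a c assume "a \<in> U i"
    then have "\<lparr>a, c \<cdot> y\<rparr> = 0" using assms(2,3,5) prd_in_U(2)[of j y c] by simp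
    then show "a \<cdot> c \<in> {x. \<lparr>x, y\<rparr> = 0}"
      using frm_prd_cyclic[of a c y] frm_commute[of a] by simp
  qed (use assms(1) in \<open>simp_all add: subspace_orthogonal\<close>)
  then show ?thesis using assms(4) by auto
qed

text \<open>If \<open>U 4\<close> were isotropic, shifting factors would give orthogonality of
  \<open>U 5\<close> and \<open>U 3\<close>, of \<open>U 6\<close> and \<open>U 2\<close>, and of
  \<open>U 7\<close> and the whole space, so \<open>U 7\<close> would vanish.\<close>

lemma U4_not_isotropic: obtains x y where "x \<in> U 4" "y \<in> U 4" "\<lparr>x, y\<rparr> \<noteq> 0"
proof -
  have False if 4: "\<And>x y. x \<in> U 4 \<Longrightarrow> y \<in> U (Suc 3) \<Longrightarrow> \<lparr>x, y\<rparr> = 0"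
  proof -
    have 5: "\<lparr>x, y\<rparr> = 0" if "x \<in> U (Suc 4)" "y \<in> U 3" for x y
      using that by (intro U_orth_shift[of 4 3 x y] 4) simp_all
    have 6: "\<lparr>x, y\<rparr> = 0" if "x \<in> U (Suc 5)" "y \<in> U 2" for x y
      using that by (intro U_orth_shift[of 5 2 x y] 5) simp_all
    have 7: "\<lparr>x, y\<rparr> = 0" if "x \<in> U (Suc 6)" "y \<in> U 1" for x y
      using that by (intro U_orth_shift[of 6 1 x y] 6) (simp_all add: numeral_2_eq_2)
    have "x = 0" if "x \<in> U 7" for x
      using 7[of x] that by (intro frm_nondegenerate) simp
    then show False using U7 U_closed(5)[of 7] by auto
  qed
  then show ?thesis using that by fastforce
qed

lemma U_subset_perp:
  "1 \<le> i \<Longrightarrow> 1 \<le> j \<Longrightarrow> 9 \<le> i + j \<Longrightarrow> U i \<subseteq> perp (U j)"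
  using U_orth by (auto simp: perp_def)

text \<open>
  If $L^4$ had dimension 5 then $L^5$ would have codimension 1 in it, and $L^4$ would be isotropic
  since $L^5 \perp L^4$.
\<close>

lemma dim_U:
  "dim (U 3) = 7" "dim (U 4) = 6" "dim (U 5) = 4" "dim (U 6) = 3"
proof -
  have sum: "dim (U i) + dim (U j) \<le> 10" if "1 \<le> i" "1 \<le> j" "9 \<le> i + j" for i j
    using dim_perp[OF subspace_U, of j] dim_subset[OF U_subset_perp[OF that]] dim_UNIV_eq by simp
  have d7: "dim (U 7) = 2"
    using dim_perp[OF subspace_U, of 2] dim_U2 dim_UNIV_eq U7_eq_perp by simp
  obtain a b where g: "generates a b" by (rule generators_exist)
  have "U 2 \<subseteq> span (insert (a \<cdot> b) (U 3))"
    using U2_modulo_U3[OF g] span_insert_U by blast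
  then have "dim (U 2) \<le> dim (insert (a \<cdot> b) (U 3))" by (rule dim_mono)
  then have d3: "7 \<le> dim (U 3)" using dim_U2 by (simp add: dim_insert split: if_splits)
  have less: "dim (U 7) < dim (U 6)" "dim (U 6) < dim (U 5)" "dim (U 5) < dim (U 4)"
    using dim_U_Suc_less[of 6] dim_U_Suc_less[of 5] dim_U_Suc_less[of 4] by simp_all
  have s: "dim (U 6) + dim (U 3) \<le> 10" "dim (U 5) + dim (U 4) \<le> 10" by (rule sum; simp)+
  have "dim (U 4) \<noteq> 5"
  proof
    assume d4: "dim (U 4) = 5"
    then have d5: "dim (U 5) = 4" using less d7 by linarith
    obtain x y where xy: "x \<in> U 4" "y \<in> U 4" "\<lparr>x, y\<rparr> \<noteq> 0" by (rule U4_not_isotropic)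
    then have "y \<notin> U 5" using U_orth[of x 4 y 5] by auto
    then obtain c where c: "x - c \<star> y \<in> U 5"
      using subspace_codim1[of "U 5" "U 4" y x] subspace_U U_antimono[of 4 5] d4 d5 xy by auto
    have "\<lparr>x - c \<star> y, y\<rparr> = 0" using c xy(2) by (rule U_orth) simp_all
    then show False using xy by simp
  qed
  \<comment> \<open>Strict descent to \<open>dim (U 7) = 2\<close> gives the lower bounds 3, 4, 5
    for \<open>U 6\<close>, \<open>U 5\<close>, \<open>U 4\<close>. With \<open>dim (U 3)\<close> at
    least 7 the sums bounded by 10 leave 3 and 7 for \<open>U 6\<close> and \<open>U 3\<close>, and
    for \<open>U 4\<close> only 5 or 6.\<close>
  then show "dim (U 3) = 7" "dim (U 4) = 6" "dim (U 5) = 4" "dim (U 6) = 3"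
    using s less d7 d3 by linarith+
qed

lemma U_eq_perp: "U 4 = perp (U 5)" "U 5 = perp (U 4)" "U 6 = perp (U 3)"
proof -
  have *: "U i = perp (U j)" if "1 \<le> i" "1 \<le> j" "9 \<le> i + j" "dim (U i) + dim (U j) = 10" for i j
    using dim_perp[OF subspace_U, of j] dim_UNIV_eq that
    by (intro subspace_dim_equal subspace_U subspace_perp U_subset_perp) simp_all
  show "U 4 = perp (U 5)" "U 5 = perp (U 4)" "U 6 = perp (U 3)"
    by (rule *; simp add: dim_U)+
qed

end

context saa_10_2_7
begin

subsection \<open>Normalising two generators\<close>

text \<open>Modulo \<open>U 3\<close> the power \<open>U 2\<close> is the line through u = ab, and
  uu = 0; so only ua and ub survive.\<close>

lemma U3_modulo_U4:
  assumes g: "generates a b"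
  shows "U 3 \<subseteq> span (insert (a \<cdot> b \<cdot> a) (insert (a \<cdot> b \<cdot> b) (U 4)))"
proof -
  let ?u = "a \<cdot> b"
  have "U (Suc 2) \<subseteq> span (insert (?u \<cdot> a) (insert (?u \<cdot> b) (U 4)))"
  proof (rule U_Suc_least)
    fix s y assume s: "s \<in> U 2"
    obtain k where k: "s - k \<star> ?u \<in> U 3" using U2_modulo_U3[OF g s] .
    obtain c d where cd: "y - (c \<star> a + d \<star> b) \<in> U 2" using generatesE[OF g] .
    obtain m where m: "(y - (c \<star> a + d \<star> b)) - m \<star> ?u \<in> U 3" using U2_modulo_U3[OF g cd] .
    have "(s - k \<star> ?u) \<cdot> y + k \<star> (?u \<cdot> ((y - (c \<star> a + d \<star> b)) - m \<star> ?u)) \<in> U 4"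
      by (rule U_closed(1)[OF prd_in(1)[OF k] U_closed(4)[OF prd_in(2)[OF m]]]) simp_all
    then have "s \<cdot> y - ((k * c) \<star> (?u \<cdot> a) + (k * d) \<star> (?u \<cdot> b)) \<in> U 4"
      by (simp add: algebra_simps scale_right_distrib scale_right_diff_distrib)
    then show "s \<cdot> y \<in> span (insert (?u \<cdot> a) (insert (?u \<cdot> b) (U 4)))"
      unfolding span_insert2_U by blast
  qed simp_all
  then show ?thesis by simp
qed

text \<open>The form on \<open>U 4\<close> descends to the quotient by \<open>U 5\<close>, which is
  a plane.\<close>

lemma frm_add_U5:
  assumes "x \<in> U 4" "y \<in> U 4" "e \<in> U 5" "f \<in> U 5"
  shows "\<lparr>x + e, y + f\<rparr> = \<lparr>x, y\<rparr>"
  using U_orth[OF assms(1,4)] U_orth[OF assms(3,2)] U_orth[OF assms(3,4)] by simp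

text \<open>\<open>U 3\<close> has codimension 1 over \<open>U 4\<close>, so ua and ub are
  proportional modulo \<open>U 4\<close>. Replacing a by a - cb keeps u and clears ua; if instead ub
  is the one in \<open>U 4\<close>, the pair b, -a also has product u.\<close>

lemma generators_exist_4: obtains a b where "generates a b" "a \<cdot> b \<cdot> a \<in> U 4"
proof -
  obtain a b where g: "generates a b" by (rule generators_exist)
  let ?u = "a \<cdot> b"
  have u: "?u \<in> U 2" by (rule prd_in_U2)
  have u3: "?u \<cdot> x \<in> U 3" for x by (rule prd_in(1)[OF u]) simp_all
  show ?thesis
  proof (cases "?u \<cdot> b \<in> U 4")
    case True
    then show ?thesis using that[of b "- a"] generates_swap[OF g] prd_commute[of b a] by simp
  next
    case False
    obtain c where c: "?u \<cdot> a - c \<star> (?u \<cdot> b) \<in> U 4"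
      using subspace_codim1[OF subspace_U subspace_U U_antimono _ u3 False u3] dim_U by auto
    have "(a + (- c) \<star> b) \<cdot> b = ?u" by simp
    then have "(a + (- c) \<star> b) \<cdot> b \<cdot> (a + (- c) \<star> b) = ?u \<cdot> a - c \<star> (?u \<cdot> b)" by simp
    then show ?thesis using that[of "a + (- c) \<star> b" b] generates_add_multiple(1)[OF g, of "- c"] c by metis
  qed
qed

section \<open>Lower powers in terms of a, b, u and v\<close>

context
  fixes a b u v
  assumes g: "generates a b" and u: "u = a \<cdot> b" and v: "v = u \<cdot> b" and ua: "u \<cdot> a \<in> U 4"
begin

lemma u_in: "u \<in> U 2" unfolding u by (rule prd_in_U2)

lemma v_in: "v \<in> U 3" unfolding v by (rule prd_in(1)[OF u_in]) simp_all

lemma vx_in: "v \<cdot> x \<in> U 4" by (rule prd_in(1)[OF v_in]) simp_all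

lemma v_notin: "v \<notin> U 4"
proof
  assume "v \<in> U 4"
  then have "insert (a \<cdot> b \<cdot> a) (insert (a \<cdot> b \<cdot> b) (U 4)) \<subseteq> U 4" using ua unfolding v u by simp
  then have "span (insert (a \<cdot> b \<cdot> a) (insert (a \<cdot> b \<cdot> b) (U 4))) \<subseteq> U 4"
    using subspace_U by (rule span_minimal)
  then have "U 3 \<subseteq> U 4" using U3_modulo_U4[OF g] by blast
  then have "dim (U 3) \<le> dim (U 4)" by (rule dim_subset)
  then show False using dim_U by simp
qed

lemma U3_modulo_U4': assumes x: "x \<in> U 3" obtains c where "x - c \<star> v \<in> U 4"
  using subspace_codim1[OF subspace_U subspace_U U_antimono _ v_in v_notin x] dim_U by auto

lemma U2_decomposition:
  assumes x: "x \<in> U 2" obtains c d where "x - (c \<star> u + d \<star> v) \<in> U 4"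
proof -
  obtain c where c: "x - c \<star> u \<in> U 3" using U2_modulo_U3[OF g x] unfolding u .
  obtain d where "(x - c \<star> u) - d \<star> v \<in> U 4" using U3_modulo_U4'[OF c] .
  then show ?thesis using that[of c d] by (simp add: diff_diff_eq)
qed

lemma generates_eq_0':
  assumes "\<lparr>w, a\<rparr> = 0" "\<lparr>w, b\<rparr> = 0" "\<lparr>w, u\<rparr> = 0" "\<lparr>w, v\<rparr> = 0" "\<And>z. z \<in> U 4 \<Longrightarrow> \<lparr>w, z\<rparr> = 0"
  shows "w = 0"
proof (rule generates_eq_0[OF g assms(1,2)])
  fix z assume z: "z \<in> U 2"
  obtain c d where "z - (c \<star> u + d \<star> v) \<in> U 4" using U2_decomposition[OF z] .
  then have "\<lparr>w, z - (c \<star> u + d \<star> v)\<rparr> = 0" by (rule assms(5))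
  then show "\<lparr>w, z\<rparr> = 0" using assms(3,4) by simp
qed

text \<open>Modulo \<open>U 4\<close>, \<open>U 3\<close> is spanned by v and \<open>U 2\<close> by
  u and v. Since vv = 0, only vu remains.\<close>

lemma U3_U2_prd:
  assumes x: "x \<in> U 3" and y: "y \<in> U 2" obtains c where "x \<cdot> y - c \<star> (v \<cdot> u) \<in> U 5"
proof -
  obtain k where k: "x - k \<star> v \<in> U 4" using U3_modulo_U4'[OF x] .
  obtain c d where cd: "y - (c \<star> u + d \<star> v) \<in> U 4" using U2_decomposition[OF y] .
  have "(x - k \<star> v) \<cdot> y + k \<star> (v \<cdot> (y - (c \<star> u + d \<star> v))) \<in> U 5"
    by (rule U_closed(1)[OF prd_in(1)[OF k] U_closed(4)[OF prd_in(2)[OF cd]]]) simp_all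
  then have "x \<cdot> y - (k * c) \<star> (v \<cdot> u) \<in> U 5"
    by (simp add: scale_right_distrib scale_right_diff_distrib)
  then show ?thesis by (rule that)
qed

text \<open>A provisional spanning set: three vectors for a plane. Which two of them suffice is
  known only once (va, vu) is shown to be non-zero.\<close>

lemma U4_decomposition:
  assumes "x \<in> U 4" obtains c d e where "x - (c \<star> (v \<cdot> a) + d \<star> (v \<cdot> b) + e \<star> (v \<cdot> u)) \<in> U 5"
proof -
  let ?S = "span (insert (v \<cdot> a) (insert (v \<cdot> b) (insert (v \<cdot> u) (U 5))))"
  have "U (Suc 3) \<subseteq> ?S"
  proof (rule U_Suc_least)
    fix s y assume s: "s \<in> U 3"
    obtain k where k: "s - k \<star> v \<in> U 4" using U3_modulo_U4'[OF s] .
    obtain c d where cd: "y - (c \<star> a + d \<star> b) \<in> U 2" using generatesE[OF g] .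
    obtain e f where ef: "(y - (c \<star> a + d \<star> b)) - (e \<star> u + f \<star> v) \<in> U 4"
      using U2_decomposition[OF cd] .
    have "(s - k \<star> v) \<cdot> y + k \<star> (v \<cdot> ((y - (c \<star> a + d \<star> b)) - (e \<star> u + f \<star> v))) \<in> U 5"
      by (rule U_closed(1)[OF prd_in(1)[OF k] U_closed(4)[OF prd_in(2)[OF ef]]]) simp_all
    then have "s \<cdot> y - ((k * c) \<star> (v \<cdot> a) + (k * d) \<star> (v \<cdot> b) + (k * e) \<star> (v \<cdot> u)) \<in> U 5"
      by (simp add: algebra_simps scale_right_distrib scale_right_diff_distrib)
    then show "s \<cdot> y \<in> ?S" unfolding span_insert3_U by blast
  qed simp_all
  then have "x \<in> ?S" using assms by auto
  then show ?thesis using that unfolding span_insert3_U by blast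
qed

text \<open>Otherwise \<open>U 4\<close> times \<open>U 3\<close> equals \<open>U 7\<close>, against
  the hypothesis. It lies in \<open>U 7\<close> because (xy, z) = (yz, x) and yz would fall into
  \<open>U 5\<close>, which is orthogonal to \<open>U 4\<close>. It exhausts \<open>U 7\<close>
  because the form on \<open>U 4\<close> would then be carried by the pair va, vb.\<close>

lemma vu_notin_U5: "v \<cdot> u \<notin> U 5"
proof
  assume vu: "v \<cdot> u \<in> U 5"
  have sub: "subspace_prod (U 4) (U 3) \<subseteq> U 7"
    unfolding subspace_prod_def
  proof (rule span_minimal[OF _ subspace_U], clarify)
    fix x y assume x: "x \<in> U 4" and y: "y \<in> U 3"
    have "\<lparr>x \<cdot> y, z\<rparr> = 0" if z: "z \<in> U 2" for z
    proof -
      obtain c where c: "y \<cdot> z - c \<star> (v \<cdot> u) \<in> U 5" using U3_U2_prd[OF y z] .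
      have "\<lparr>y \<cdot> z - c \<star> (v \<cdot> u), x\<rparr> = 0" by (rule U_orth[OF c x]) simp_all
      moreover have "\<lparr>v \<cdot> u, x\<rparr> = 0" by (rule U_orth[OF vu x]) simp_all
      ultimately show ?thesis using frm_prd_cyclic[of x y z] by simp
    qed
    then show "x \<cdot> y \<in> U 7" unfolding U7_eq_perp perp_def by blast
  qed
  obtain x y where x: "x \<in> U 4" and y: "y \<in> U 4" and xy: "\<lparr>x, y\<rparr> \<noteq> 0" by (rule U4_not_isotropic)
  \<comment> \<open>With vu in \<open>U 5\<close>, va and vb span \<open>U 4\<close> modulo
    \<open>U 5\<close>, so (va, vb) = 0 would make \<open>U 4\<close> isotropic.\<close>
  have k: "\<lparr>v \<cdot> a, v \<cdot> b\<rparr> \<noteq> 0"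
  proof
    assume 0: "\<lparr>v \<cdot> a, v \<cdot> b\<rparr> = 0"
    obtain c d e where c: "x - (c \<star> (v \<cdot> a) + d \<star> (v \<cdot> b) + e \<star> (v \<cdot> u)) \<in> U 5"
      using U4_decomposition[OF x] .
    obtain c' d' e' where c': "y - (c' \<star> (v \<cdot> a) + d' \<star> (v \<cdot> b) + e' \<star> (v \<cdot> u)) \<in> U 5"
      using U4_decomposition[OF y] .
    have "\<lparr>x - (c \<star> (v \<cdot> a) + d \<star> (v \<cdot> b) + e \<star> (v \<cdot> u)), y\<rparr> = 0" by (rule U_orth[OF c y]) simp_all
    moreover have "\<lparr>v \<cdot> a, y - (c' \<star> (v \<cdot> a) + d' \<star> (v \<cdot> b) + e' \<star> (v \<cdot> u))\<rparr> = 0"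
      "\<lparr>v \<cdot> b, y - (c' \<star> (v \<cdot> a) + d' \<star> (v \<cdot> b) + e' \<star> (v \<cdot> u))\<rparr> = 0"
      by (rule U_orth[OF vx_in c']; simp)+
    moreover have "\<lparr>v \<cdot> u, y\<rparr> = 0" "\<lparr>v \<cdot> a, v \<cdot> u\<rparr> = 0" "\<lparr>v \<cdot> b, v \<cdot> u\<rparr> = 0"
      by (rule U_orth[OF vu y] U_orth[OF vx_in vu], simp_all)+
    ultimately show False using xy 0 frm_commute[of "v \<cdot> b" "v \<cdot> a"] by simp
  qed
  have "U 7 \<subseteq> subspace_prod (U 4) (U 3)"
  proof
    fix z assume z: "z \<in> U 7"
    let ?k = "\<lparr>v \<cdot> a, v \<cdot> b\<rparr>"
    \<comment> \<open>The vectors (vb)v and (va)v are dual to a and b up to the factor k and a sign,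
      hence w has the same pairings with a and b as z.\<close>
    define w where "w = (\<lparr>z, a\<rparr> / ?k) \<star> (v \<cdot> b \<cdot> v) - (\<lparr>z, b\<rparr> / ?k) \<star> (v \<cdot> a \<cdot> v)"
    have w: "w \<in> subspace_prod (U 4) (U 3)"
      unfolding w_def subspace_prod_def using vx_in v_in
      by (intro span_diff span_scale span_base) blast+
    have zw: "z - w \<in> U 7" using z w sub by (intro U_closed(2)) auto
    have "\<lparr>v \<cdot> b \<cdot> v, a\<rparr> = ?k" "\<lparr>v \<cdot> a \<cdot> v, b\<rparr> = - ?k" "\<lparr>v \<cdot> b \<cdot> v, b\<rparr> = 0" "\<lparr>v \<cdot> a \<cdot> v, a\<rparr> = 0"
      using frm_prd_cyclic[of "v \<cdot> b" v a] frm_prd_cyclic[of "v \<cdot> a" v b]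
        frm_prd_cyclic[of "v \<cdot> b" v b] frm_prd_cyclic[of "v \<cdot> a" v a] frm_commute[of "v \<cdot> b" "v \<cdot> a"] by simp_all
    then have "z - w = 0"
      using k U_orth[OF zw, of _ 2] by (intro generates_eq_0[OF g]) (simp_all add: w_def)
    then show "z \<in> subspace_prod (U 4) (U 3)" using w by simp
  qed
  then show False using sub type_10_2_7 unfolding type_10_2_7_def by blast
qed

text \<open>If (va, vu) = 0, put z = (vu)v, an element of \<open>U 4\<close> times
  \<open>U 3\<close>. It is orthogonal to a and \<open>U 2\<close>, and (z, b) = (vb, vu) is
  non-zero since vu must pair with something in \<open>U 4\<close>. A product xy with x in
  \<open>U 5\<close>, y in \<open>U 2\<close> is also orthogonal to a and \<open>U 2\<close>,
  because ua in \<open>U 4\<close> and uu = 0 put ya and ys in \<open>U 4\<close>. So xy is a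
  multiple of z, contradicting the second inequality.\<close>

lemma va_vu_neq_0: "\<lparr>v \<cdot> a, v \<cdot> u\<rparr> \<noteq> 0"
proof
  assume 0: "\<lparr>v \<cdot> a, v \<cdot> u\<rparr> = 0"
  let ?z = "v \<cdot> u \<cdot> v"
  obtain x where x: "x \<in> U 4" "\<lparr>v \<cdot> u, x\<rparr> \<noteq> 0"
    using vu_notin_U5 unfolding U_eq_perp(2) perp_def by blast
  have b: "\<lparr>v \<cdot> b, v \<cdot> u\<rparr> \<noteq> 0"
  proof
    assume h0: "\<lparr>v \<cdot> b, v \<cdot> u\<rparr> = 0"
    obtain c d e where c: "x - (c \<star> (v \<cdot> a) + d \<star> (v \<cdot> b) + e \<star> (v \<cdot> u)) \<in> U 5"
      using U4_decomposition[OF x(1)] .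
    have "\<lparr>v \<cdot> u, x - (c \<star> (v \<cdot> a) + d \<star> (v \<cdot> b) + e \<star> (v \<cdot> u))\<rparr> = 0"
      by (rule U_orth[OF vx_in c]) simp_all
    then show False using x(2) 0 h0 frm_eq_0_sym[OF 0] frm_eq_0_sym[OF h0] by simp
  qed
  have z: "\<lparr>?z, a\<rparr> = 0" "\<lparr>?z, b\<rparr> = \<lparr>v \<cdot> b, v \<cdot> u\<rparr>"
    using 0 frm_prd_cyclic[of "v \<cdot> u" v a] frm_prd_cyclic[of "v \<cdot> u" v b] by simp_all
  have zU2: "\<lparr>?z, s\<rparr> = 0" if s: "s \<in> U 2" for s
  proof -
    obtain c where c: "v \<cdot> s - c \<star> (v \<cdot> u) \<in> U 5" using U3_U2_prd[OF v_in s] .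
    have "\<lparr>v \<cdot> s - c \<star> (v \<cdot> u), v \<cdot> u\<rparr> = 0" by (rule U_orth[OF c vx_in]) simp_all
    then show ?thesis using frm_prd_cyclic[of "v \<cdot> u" v s] by simp
  qed
  have "x \<cdot> y \<in> subspace_prod (U 4) (U 3)" if x: "x \<in> U 5" and y: "y \<in> U 2" for x y
  proof -
    obtain m where m: "y - m \<star> u \<in> U 3" using U2_modulo_U3[OF g y] unfolding u .
    have xa: "\<lparr>x \<cdot> y, a\<rparr> = 0"
    proof -
      have "(y - m \<star> u) \<cdot> a + m \<star> (u \<cdot> a) \<in> U 4"
        by (rule U_closed(1)[OF prd_in(1)[OF m] U_closed(4)[OF ua]]) simp_all
      then have "y \<cdot> a \<in> U 4" by simp
      then have "\<lparr>y \<cdot> a, x\<rparr> = 0" using x by (rule U_orth) simp_all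
      then show ?thesis using frm_prd_cyclic[of x y a] by simp
    qed
    have xs: "\<lparr>x \<cdot> y, s\<rparr> = 0" if s: "s \<in> U 2" for s
    proof -
      obtain n where n: "s - n \<star> u \<in> U 3" using U2_modulo_U3[OF g s] unfolding u .
      have "(y - m \<star> u) \<cdot> s + m \<star> (u \<cdot> (s - n \<star> u)) \<in> U 4"
        by (rule U_closed(1)[OF prd_in(1)[OF m] U_closed(4)[OF prd_in(2)[OF n]]]) simp_all
      then have "y \<cdot> s \<in> U 4" by simp
      then have "\<lparr>y \<cdot> s, x\<rparr> = 0" using x by (rule U_orth) simp_all
      then show ?thesis using frm_prd_cyclic[of x y s] by simp
    qed
    have "x \<cdot> y - (\<lparr>x \<cdot> y, b\<rparr> / \<lparr>v \<cdot> b, v \<cdot> u\<rparr>) \<star> ?z = 0"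
      using b xa xs z zU2 by (intro generates_eq_0[OF g]) simp_all
    then have "x \<cdot> y = (\<lparr>x \<cdot> y, b\<rparr> / \<lparr>v \<cdot> b, v \<cdot> u\<rparr>) \<star> ?z" by simp
    also have "\<dots> \<in> subspace_prod (U 4) (U 3)"
      unfolding subspace_prod_def using vx_in v_in by (intro span_scale span_base) blast
    finally show ?thesis .
  qed
  then have "{x \<cdot> y |x y. x \<in> U 5 \<and> y \<in> U 2} \<subseteq> subspace_prod (U 4) (U 3)" by blast
  then have "subspace_prod (U 5) (U 2) \<subseteq> subspace_prod (U 4) (U 3)"
    unfolding subspace_prod_def[of "U 5"] by (rule span_minimal) (simp add: subspace_prod_def)
  then show False using type_10_2_7 unfolding type_10_2_7_def by blast
qed

text \<open>As \<open>U 5\<close> is orthogonal to \<open>U 4\<close>, the non-zero pairing makes va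
  and vu independent modulo \<open>U 5\<close>, and the quotient has dimension 6 - 4 = 2.\<close>

lemma U4_decomposition':
  assumes x: "x \<in> U 4" obtains c d where "x - (c \<star> (v \<cdot> a) + d \<star> (v \<cdot> u)) \<in> U 5"
proof -
  have 1: "v \<cdot> a \<notin> U 5"
  proof
    assume *: "v \<cdot> a \<in> U 5"
    have "\<lparr>v \<cdot> a, v \<cdot> u\<rparr> = 0" by (rule U_orth[OF * vx_in]) simp_all
    then show False using va_vu_neq_0 by simp
  qed
  have 2: "v \<cdot> u - c \<star> (v \<cdot> a) \<notin> U 5" for c
  proof
    assume *: "v \<cdot> u - c \<star> (v \<cdot> a) \<in> U 5"
    have "\<lparr>v \<cdot> a, v \<cdot> u - c \<star> (v \<cdot> a)\<rparr> = 0" by (rule U_orth[OF vx_in *]) simp_all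
    then show False using va_vu_neq_0 by simp
  qed
  show ?thesis
    using that subspace_codim2[OF subspace_U subspace_U U_antimono _ vx_in vx_in 1 2 x] dim_U by auto
qed

text \<open>Most pairings of vb vanish by alternation: with b and v at once, with a because (vb, a)
  = -(u, ub), with u because (vb, u) = -(v, v). Only \<open>U 4\<close> needs the
  hypothesis.\<close>

lemma vb_eq_0:
  assumes "v \<cdot> b \<in> U 5" shows "v \<cdot> b = 0"
proof (rule generates_eq_0')
  show "\<lparr>v \<cdot> b, a\<rparr> = 0"
    using frm_prd_cyclic[of v b a] prd_commute[of b a] by (simp add: v u)
  show "\<lparr>v \<cdot> b, u\<rparr> = 0"
    using frm_prd_cyclic[of v b u] prd_commute[of b u] by (simp add: v)
  show "\<lparr>v \<cdot> b, z\<rparr> = 0" if "z \<in> U 4" for z by (rule U_orth[OF assms that]) simp_all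
qed simp_all

end

end

section \<open>Successive corrections of the generators\<close>

context saa_10_2_7
begin

text \<open>Stated in a and b alone, because u = ab and v = (ab)b vary with the generators.\<close>

definition almost_normal :: "'b \<Rightarrow> 'b \<Rightarrow> bool" where
  "almost_normal a b \<longleftrightarrow> generates a b \<and> a \<cdot> b \<cdot> a \<in> U 4 \<and> a \<cdot> b \<cdot> b \<cdot> b = 0 \<and>
     \<lparr>a \<cdot> b \<cdot> b \<cdot> a, a \<cdot> b \<cdot> b \<cdot> (a \<cdot> b)\<rparr> \<noteq> 0"

text \<open>
  Writing $u = ab$ and $v = ub$: replacing $b$ by $b - ca - du$ changes $v$ only modulo $L^4$ and moves
  $vb$ into $L^5$, which already forces $vb = 0$. Afterwards $a + cu$, $a + cv$ and $a + c(va)$ in turn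
  kill the pairings of $ua$ with $vu$, $va$ and $v$.
\<close>

lemma almost_normal_exists: obtains a b where "almost_normal a b"
proof -
  obtain a b where g: "generates a b" and ua': "a \<cdot> b \<cdot> a \<in> U 4" by (rule generators_exist_4)
  define u where u: "u = a \<cdot> b"
  define v where v: "v = u \<cdot> b"
  have ua: "u \<cdot> a \<in> U 4" using ua' unfolding u .
  note ctx = g u v ua
  have vin: "v \<in> U 3" by (rule v_in[OF ctx])
  have vb: "v \<cdot> b \<in> U 4" by (rule vx_in[OF ctx])
  obtain c d where cd: "v \<cdot> b - (c \<star> (v \<cdot> a) + d \<star> (v \<cdot> u)) \<in> U 5"
    using U4_decomposition'[OF ctx vb] .
  define b' where b': "b' = b + (- c) \<star> a + (- d) \<star> u"
  define u' where u'_def: "u' = a \<cdot> b'"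
  define v' where v'_def: "v' = u' \<cdot> b'"
  have u': "u' = u + d \<star> (u \<cdot> a)"
    unfolding u'_def b' using prd_commute[of a u] by (simp add: u[symmetric])
  have ua_b': "u \<cdot> a \<cdot> b' \<in> U 5" by (rule prd_in(1)[OF ua]) simp_all
  define e where e: "e = d \<star> (u \<cdot> a \<cdot> b') - c \<star> (u \<cdot> a)"
  have e4: "e \<in> U 4"
    unfolding e by (intro U_closed(2,4) ua U_mono[OF ua_b']) simp
  have v': "v' = v + e"
    unfolding v'_def u' e
    by (simp add: b' v algebra_simps scale_right_distrib scale_right_diff_distrib)
  have g': "generates a b'"
    unfolding b' by (intro generates_add(2) generates_add_multiple(2) g U_closed(4) u_in[OF ctx])
  have u'a: "u' \<cdot> a \<in> U 4"
  proof -
    have "u \<cdot> a + d \<star> (u \<cdot> a \<cdot> a) \<in> U 4" by (intro U_closed(1,4) ua prd_in(1)[OF ua]) simp_all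
    then show ?thesis by (simp add: u')
  qed
  have ex: "e \<cdot> x \<in> U 5" for x by (rule prd_in(1)[OF e4]) simp_all
  have v'b': "v' \<cdot> b' \<in> U 5"
  proof -
    have "(v \<cdot> b - (c \<star> (v \<cdot> a) + d \<star> (v \<cdot> u))) + e \<cdot> b' \<in> U 5" by (rule U_closed(1)[OF cd ex])
    then show ?thesis by (simp add: v' b' algebra_simps)
  qed
  \<comment> \<open>The change of generators alters va and vu only by elements of
    \<open>U 5\<close>, which the form on \<open>U 4\<close> does not see.\<close>
  have "\<lparr>v' \<cdot> a, v' \<cdot> u'\<rparr> = \<lparr>v \<cdot> a + e \<cdot> a, v \<cdot> u + (d \<star> (v \<cdot> (u \<cdot> a)) + e \<cdot> u')\<rparr>"
    unfolding v' u' by (simp add: algebra_simps)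
  also have "\<dots> = \<lparr>v \<cdot> a, v \<cdot> u\<rparr>"
    by (rule frm_add_U5[OF vx_in[OF ctx] vx_in[OF ctx] ex])
      (intro U_closed(1,4) ex prd_in(2)[OF ua], simp_all)
  finally have "\<lparr>v' \<cdot> a, v' \<cdot> u'\<rparr> \<noteq> 0" using va_vu_neq_0[OF ctx] by simp
  moreover have "v' \<cdot> b' = 0" by (rule vb_eq_0[OF g' u'_def v'_def u'a v'b'])
  ultimately have "almost_normal a b'"
    unfolding almost_normal_def using g' u'a by (simp add: u'_def v'_def)
  then show ?thesis by (rule that)
qed

lemma almost_normal_exists_1:
  obtains a b where "almost_normal a b" "\<lparr>a \<cdot> b \<cdot> a, a \<cdot> b \<cdot> b \<cdot> (a \<cdot> b)\<rparr> = 0"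
proof -
  obtain a b where n: "almost_normal a b" by (rule almost_normal_exists)
  define u where u: "u = a \<cdot> b"
  define v where v: "v = u \<cdot> b"
  have g: "generates a b" and ua: "u \<cdot> a \<in> U 4" and vb: "v \<cdot> b = 0" and k: "\<lparr>v \<cdot> a, v \<cdot> u\<rparr> \<noteq> 0"
    using n unfolding almost_normal_def by (simp_all add: u v)
  note ctx = g u v ua
  \<comment> \<open>Since vb = 0, the new u is u + cv while v and vu stay. The new ua is ua + c va +
    c^2 vu; its pairing with vu is (ua, vu) + c (va, vu), the square term dropping out.\<close>
  define c where c: "c = - \<lparr>u \<cdot> a, v \<cdot> u\<rparr> / \<lparr>v \<cdot> a, v \<cdot> u\<rparr>"
  define a' where a': "a' = a + c \<star> u"
  have a'b: "a' \<cdot> b = u + c \<star> v" by (simp add: a' u[symmetric] v[symmetric])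
  have v': "a' \<cdot> b \<cdot> b = v" by (simp add: a'b v[symmetric] vb)
  have u'a': "a' \<cdot> b \<cdot> a' = u \<cdot> a + c \<star> (v \<cdot> a) + (c * c) \<star> (v \<cdot> u)"
    unfolding a'b by (simp add: a' scale_right_distrib algebra_simps)
  have va': "v \<cdot> a' = v \<cdot> a + c \<star> (v \<cdot> u)" by (simp add: a')
  have vu': "v \<cdot> (a' \<cdot> b) = v \<cdot> u" by (simp add: a'b)
  have "u \<cdot> a + c \<star> (v \<cdot> a) + (c * c) \<star> (v \<cdot> u) \<in> U 4"
    by (intro U_closed(1,4) ua vx_in[OF ctx])
  then have "almost_normal a' b"
    unfolding almost_normal_def v' u'a' va' vu' using vb k
    by (simp add: a' generates_add(1)[OF g] U_closed(4)[OF u_in[OF ctx]])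
  moreover have "\<lparr>a' \<cdot> b \<cdot> a', a' \<cdot> b \<cdot> b \<cdot> (a' \<cdot> b)\<rparr> = 0"
    unfolding v' u'a' vu' using k by (simp add: c)
  ultimately show ?thesis by (rule that)
qed

lemma almost_normal_exists_2:
  obtains a b where "almost_normal a b" "a \<cdot> b \<cdot> a \<in> U 5"
proof -
  obtain a b where n: "almost_normal a b" and n1: "\<lparr>a \<cdot> b \<cdot> a, a \<cdot> b \<cdot> b \<cdot> (a \<cdot> b)\<rparr> = 0"
    by (rule almost_normal_exists_1)
  define u where u: "u = a \<cdot> b"
  define v where v: "v = u \<cdot> b"
  have g: "generates a b" and ua: "u \<cdot> a \<in> U 4" and vb: "v \<cdot> b = 0" and k: "\<lparr>v \<cdot> a, v \<cdot> u\<rparr> \<noteq> 0"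
    and uavu: "\<lparr>u \<cdot> a, v \<cdot> u\<rparr> = 0"
    using n n1 unfolding almost_normal_def by (simp_all add: u v)
  note ctx = g u v ua
  \<comment> \<open>Adding cv to a keeps u, v and va, and changes ua by -c vu. This leaves its
    pairing with vu at zero and adds c (va, vu) to its pairing with va. Orthogonality to both basis
    vectors of \<open>U 4\<close> modulo \<open>U 5\<close> then means membership in
    \<open>U 5\<close>.\<close>
  define c where c: "c = - \<lparr>u \<cdot> a, v \<cdot> a\<rparr> / \<lparr>v \<cdot> a, v \<cdot> u\<rparr>"
  define a' where a': "a' = a + c \<star> v"
  have a'b: "a' \<cdot> b = u" by (simp add: a' u[symmetric] vb)
  have u'a': "u \<cdot> a' = u \<cdot> a + (- c) \<star> (v \<cdot> u)"
    using prd_commute[of u v] by (simp add: a')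
  have va': "v \<cdot> a' = v \<cdot> a" by (simp add: a')
  have u'a'4: "u \<cdot> a' \<in> U 4" unfolding u'a' by (intro U_closed(1,4) ua vx_in[OF ctx])
  have v2: "v \<in> U 2" by (rule U_mono[OF v_in[OF ctx]]) simp
  have "almost_normal a' b"
    unfolding almost_normal_def a'b v[symmetric] va' using vb k u'a'4
    by (simp add: a' generates_add(1)[OF g] U_closed(4)[OF v2])
  moreover have "a' \<cdot> b \<cdot> a' \<in> U 5"
    unfolding U_eq_perp(2) perp_def a'b
  proof (clarify)
    fix x assume x: "x \<in> U 4"
    obtain d e where de: "x - (d \<star> (v \<cdot> a) + e \<star> (v \<cdot> u)) \<in> U 5" using U4_decomposition'[OF ctx x] .
    have "\<lparr>u \<cdot> a', x - (d \<star> (v \<cdot> a) + e \<star> (v \<cdot> u))\<rparr> = 0" by (rule U_orth[OF u'a'4 de]) simp_all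
    moreover have "\<lparr>u \<cdot> a', v \<cdot> a\<rparr> = 0" "\<lparr>u \<cdot> a', v \<cdot> u\<rparr> = 0"
      unfolding u'a' using k uavu frm_commute[of "v \<cdot> u" "v \<cdot> a"] by (simp_all add: c)
    ultimately show "\<lparr>u \<cdot> a', x\<rparr> = 0" by simp
  qed
  ultimately show ?thesis by (rule that)
qed

lemma almost_normal_exists_3:
  obtains a b where "almost_normal a b" "a \<cdot> b \<cdot> a = 0"
proof -
  obtain a b where n: "almost_normal a b" and ua5: "a \<cdot> b \<cdot> a \<in> U 5"
    by (rule almost_normal_exists_2)
  define u where u: "u = a \<cdot> b"
  define v where v: "v = u \<cdot> b"
  define t where t: "t = v \<cdot> a \<cdot> b"
  have g: "generates a b" and ua: "u \<cdot> a \<in> U 4" and vb: "v \<cdot> b = 0" and k: "\<lparr>v \<cdot> a, v \<cdot> u\<rparr> \<noteq> 0"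
    using n unfolding almost_normal_def by (simp_all add: u v)
  note ctx = g u v ua
  \<comment> \<open>(t, s) = (bs, va). Modulo \<open>U 5\<close> the product bs is a multiple of v,
    as bu = -v and bv = 0, and (v, va) = 0.\<close>
  have t_center: "t \<in> center"
    unfolding center_eq_perp perp_def
  proof clarify
    fix s assume s: "s \<in> U 2"
    obtain m d where md: "s - (m \<star> u + d \<star> v) \<in> U 4" using U2_decomposition[OF ctx s] .
    have "b \<cdot> (s - (m \<star> u + d \<star> v)) \<in> U 5" by (rule prd_in(2)[OF md]) simp_all
    then have "\<lparr>b \<cdot> (s - (m \<star> u + d \<star> v)), v \<cdot> a\<rparr> = 0" using vx_in[OF ctx] by (rule U_orth) simp_all
    then have "\<lparr>b \<cdot> s, v \<cdot> a\<rparr> = 0"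
      using prd_commute[of b u] prd_commute[of b v] vb by (simp add: v[symmetric])
    then show "\<lparr>t, s\<rparr> = 0" unfolding t using frm_prd_cyclic[of "v \<cdot> a" b s] by simp
  qed
  then have t0: "t \<cdot> x = 0" "x \<cdot> t = 0" for x using prd_commute[of x t] by (simp_all add: center_def)
  have tperp: "\<lparr>x, t\<rparr> = 0" if "x \<in> U 2" for x
    using t_center that frm_eq_0_sym[of t x] unfolding center_eq_perp perp_def by blast
  \<comment> \<open>Since t is central, adding c va to a leaves v unchanged and turns ua into ua + c
    u(va). As (u(va), v) = -(va, vu), this c makes the pairing with v vanish.\<close>
  define c where c: "c = \<lparr>u \<cdot> a, v\<rparr> / \<lparr>v \<cdot> a, v \<cdot> u\<rparr>"
  define a' where a': "a' = a + c \<star> (v \<cdot> a)"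
  have a'b: "a' \<cdot> b = u + c \<star> t" by (simp add: a' u[symmetric] t[symmetric])
  have v': "a' \<cdot> b \<cdot> b = v" by (simp add: a'b v[symmetric] t0)
  have u'a': "a' \<cdot> b \<cdot> a' = u \<cdot> a + c \<star> (u \<cdot> (v \<cdot> a))"
    unfolding a'b by (simp add: a' t0)
  have va': "v \<cdot> a' = v \<cdot> a + c \<star> (v \<cdot> (v \<cdot> a))" by (simp add: a')
  have vu': "v \<cdot> (a' \<cdot> b) = v \<cdot> u" by (simp add: a'b t0)
  have uva: "u \<cdot> (v \<cdot> a) \<in> U 5" by (rule prd_in(2)[OF vx_in[OF ctx]]) simp_all
  have vva: "v \<cdot> (v \<cdot> a) \<in> U 5" by (rule prd_in(2)[OF vx_in[OF ctx]]) simp_all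
  have w5: "a' \<cdot> b \<cdot> a' \<in> U 5"
    unfolding u'a' using ua5 uva by (intro U_closed(1,4)) (simp_all add: u)
  have g': "generates a' b"
    unfolding a' by (intro generates_add(1)[OF g] U_closed(4) prd_in_U2)
  \<comment> \<open>Membership in \<open>U 5\<close> covers pairings with \<open>U 4\<close>, the
    choice of c covers v, and a', b, u follow from alternation, the new u differing from the old by
    a vector orthogonal to \<open>U 2\<close>.\<close>
  have w0: "a' \<cdot> b \<cdot> a' = 0"
  proof (rule generates_eq_0[OF g'])
    show "\<lparr>a' \<cdot> b \<cdot> a', a'\<rparr> = 0" by simp
    show "\<lparr>a' \<cdot> b \<cdot> a', b\<rparr> = 0" using frm_prd_cyclic[of "a' \<cdot> b" a' b] by simp
    have w2: "a' \<cdot> b \<cdot> a' \<in> U 2" by (rule prd_in_U2)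
    have "\<lparr>a' \<cdot> b \<cdot> a', u + c \<star> t\<rparr> = 0" unfolding a'b[symmetric] by simp
    then have wu: "\<lparr>a' \<cdot> b \<cdot> a', u\<rparr> = 0" using tperp[OF w2] by simp
    have wv: "\<lparr>a' \<cdot> b \<cdot> a', v\<rparr> = 0"
      unfolding u'a' using k frm_prd_cyclic[of u "v \<cdot> a" v] frm_prd_cyclic[of "v \<cdot> a" v u]
        frm_commute[of "v \<cdot> u" "v \<cdot> a"] by (simp add: c)
    fix s assume s: "s \<in> U 2"
    obtain m d where md: "s - (m \<star> u + d \<star> v) \<in> U 4" using U2_decomposition[OF ctx s] .
    have "\<lparr>a' \<cdot> b \<cdot> a', s - (m \<star> u + d \<star> v)\<rparr> = 0" by (rule U_orth[OF w5 md]) simp_all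
    then show "\<lparr>a' \<cdot> b \<cdot> a', s\<rparr> = 0" using wu wv by simp
  qed
  have "\<lparr>v \<cdot> (v \<cdot> a), v \<cdot> u\<rparr> = 0" by (rule U_orth[OF vva vx_in[OF ctx]]) simp_all
  then have "almost_normal a' b"
    unfolding almost_normal_def v' va' vu' w0 using vb k g' by (simp add: U_closed(5))
  then show ?thesis using w0 by (rule that)
qed

lemma normal_generators_exist:
  obtains a b u v where "generates a b" "u = a \<cdot> b" "v = u \<cdot> b" "u \<cdot> a = 0" "v \<cdot> b = 0"
    "\<lparr>v \<cdot> a, v \<cdot> u\<rparr> = - 1" "\<lparr>a, b\<rparr> = 0"
proof -
  obtain a0 b0 where n: "almost_normal a0 b0" and ua0: "a0 \<cdot> b0 \<cdot> a0 = 0"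
    by (rule almost_normal_exists_3)
  define k where k: "k = \<lparr>a0 \<cdot> b0 \<cdot> b0 \<cdot> a0, a0 \<cdot> b0 \<cdot> b0 \<cdot> (a0 \<cdot> b0)\<rparr>"
  have k0: "k \<noteq> 0" using n unfolding almost_normal_def k by blast
  \<comment> \<open>The factors have product 1, so u is unchanged, v is multiplied by -1/k and va is
    unchanged; hence (va, vu) becomes (-1/k) k = -1.\<close>
  define a where a: "a = (- k) \<star> a0"
  define b where b: "b = (- 1 / k) \<star> b0"
  define u where u: "u = a \<cdot> b"
  define v where v: "v = u \<cdot> b"
  have u': "u = a0 \<cdot> b0" unfolding u a b using k0 by simp
  have v': "v = (- 1 / k) \<star> (a0 \<cdot> b0 \<cdot> b0)" unfolding v u' b by simp
  have g: "generates a b"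
    unfolding a b using n k0 unfolding almost_normal_def by (intro generates_scale) simp_all
  have ua: "u \<cdot> a = 0" unfolding u' a using ua0 by simp
  have vb: "v \<cdot> b = 0" unfolding v' b using n by (simp add: almost_normal_def)
  have kap: "\<lparr>v \<cdot> a, v \<cdot> u\<rparr> = - 1" unfolding v' u' a using k0 k by simp
  have ua4: "u \<cdot> a \<in> U 4" unfolding ua by (rule U_closed(5))
  note ctx = g u v ua4
  \<comment> \<open>A central vector with (z, b) = -1: adding (a, b) z to a cancels the pairing with
    b and affects no product.\<close>
  define z where z: "z = v \<cdot> u \<cdot> a \<cdot> u"
  have vua: "v \<cdot> u \<cdot> a \<in> U 5" by (rule prd_in(1)[OF vx_in[OF ctx]]) simp_all
  have "z \<in> center"
    unfolding center_eq_perp perp_def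
  proof clarify
    fix s assume s: "s \<in> U 2"
    obtain m where m: "s - m \<star> u \<in> U 3" using U2_modulo_U3[OF g s] unfolding u .
    have "u \<cdot> (s - m \<star> u) \<in> U 4" by (rule prd_in(2)[OF m]) simp_all
    then have "\<lparr>u \<cdot> (s - m \<star> u), v \<cdot> u \<cdot> a\<rparr> = 0" using vua by (rule U_orth) simp_all
    then show "\<lparr>z, s\<rparr> = 0" unfolding z using frm_prd_cyclic[of "v \<cdot> u \<cdot> a" u s] by simp
  qed
  then have z0: "z \<cdot> x = 0" "x \<cdot> z = 0" for x using prd_commute[of x z] by (simp_all add: center_def)
  have zb: "\<lparr>z, b\<rparr> = - 1"
  proof -
    have "\<lparr>z, b\<rparr> = \<lparr>v, v \<cdot> u \<cdot> a\<rparr>" unfolding z frm_prd_cyclic[of "v \<cdot> u \<cdot> a" u b] v[symmetric] ..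
    also have "\<dots> = - \<lparr>v \<cdot> u \<cdot> a, v\<rparr>" by (rule frm_commute)
    also have "\<dots> = - \<lparr>a \<cdot> v, v \<cdot> u\<rparr>" unfolding frm_prd_cyclic[of "v \<cdot> u" a v] ..
    also have "\<dots> = - 1" using kap prd_commute[of a v] by simp
    finally show ?thesis .
  qed
  define a' where a': "a' = a + \<lparr>a, b\<rparr> \<star> z"
  have "u \<cdot> a' = 0" "v \<cdot> a' = v \<cdot> a" "a' \<cdot> b = u" "\<lparr>a', b\<rparr> = 0"
    by (simp_all add: a' z0 ua u[symmetric] zb)
  moreover have "generates a' b"
    unfolding a' z by (intro generates_add(1)[OF g] U_closed(4) prd_in_U2)
  ultimately show ?thesis using that[of a' b u v] v vb kap by simp
qed

end
subsection \<open>Standard bases and presentations\<close>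

fun list_family :: "'a list \<Rightarrow> 'a list \<Rightarrow> basis_index \<Rightarrow> 'a" where
  "list_family xs ys (Xi i) = xs ! (i - 1)"
| "list_family xs ys (Yi i) = ys ! (i - 1)"

lemma basis_indices_5:
  "basis_indices 5 = {Xi 1, Xi 2, Xi 3, Xi 4, Xi 5, Yi 1, Yi 2, Yi 3, Yi 4, Yi 5}"
proof -
  have "{1..5::nat} = {1, 2, 3, 4, 5}" by auto
  then show ?thesis by (simp add: basis_indices_def insert_commute)
qed

lemma finite_basis_indices: "finite (basis_indices n)"
  by (simp add: basis_indices_def)

lemma card_basis_indices: "card (basis_indices n) = 2 * n"
  unfolding basis_indices_def
  by (subst card_Un_disjoint) (auto simp: card_image inj_on_def)

context symplectic_alternating_algebra
begin

fun dual_vector :: "(basis_index \<Rightarrow> 'v) \<Rightarrow> basis_index \<Rightarrow> 'v" where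
  "dual_vector b (Xi i) = b (Yi i)"
| "dual_vector b (Yi i) = - b (Xi i)"

definition gram_standard :: "nat \<Rightarrow> (basis_index \<Rightarrow> 'v) \<Rightarrow> bool" where
  "gram_standard n b \<longleftrightarrow> (\<forall>i\<in>{1..n}. \<forall>j\<in>{1..n}.
     \<lparr>b (Xi i), b (Xi j)\<rparr> = 0 \<and> \<lparr>b (Yi i), b (Yi j)\<rparr> = 0 \<and>
     \<lparr>b (Xi i), b (Yi j)\<rparr> = (if i = j then 1 else 0))"

lemma frm_dual_vector:
  assumes "gram_standard n b" "i \<in> basis_indices n" "j \<in> basis_indices n"
  shows "\<lparr>b i, dual_vector b j\<rparr> = (if i = j then 1 else 0)"
proof -
  have yx: "\<lparr>b (Yi k), b (Xi l)\<rparr> = - (if k = l then 1 else 0)" if "k \<in> {1..n}" "l \<in> {1..n}" for k l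
    using assms(1) that frm_commute[of "b (Yi k)" "b (Xi l)"] by (auto simp: gram_standard_def)
  show ?thesis
    using assms yx by (cases i; cases j) (auto simp: gram_standard_def basis_indices_def)
qed

text \<open>The Gram matrix alone exhibits a dual family, hence independence; counting against the
  dimension gives spanning.\<close>

lemma standard_basisI:
  assumes "dim UNIV = 2 * n" "gram_standard n b" shows "standard_basis n b"
proof -
  have ind: "inj_on b (basis_indices n)" "independent (b ` basis_indices n)"
    using dual_family_independent[of "basis_indices n" b "dual_vector b"]
      frm_dual_vector[OF assms(2)] finite_basis_indices by auto
  have "card (b ` basis_indices n) = dim UNIV"
    using ind(1) assms(1) by (simp add: card_image card_basis_indices)
  then have "UNIV \<subseteq> span (b ` basis_indices n)"
    using ind(2) by (intro card_ge_dim_independent) auto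
  then show ?thesis
    using ind assms(2) unfolding standard_basis_def gram_standard_def by blast
qed

end

lemma (in saa_10_2_7) has_presentation: "has_presentation 5 P10_2_7"
proof -
  obtain a b u v where g: "generates a b" and u: "u = a \<cdot> b" and v: "v = u \<cdot> b"
    and ua: "u \<cdot> a = 0" and vb: "v \<cdot> b = 0" and kap: "\<lparr>v \<cdot> a, v \<cdot> u\<rparr> = - 1" and ab: "\<lparr>a, b\<rparr> = 0"
    by (rule normal_generators_exist)
  have ua4: "u \<cdot> a \<in> U 4" unfolding ua by (rule U_closed(5))
  note ctx = g u v ua4
  define y1 where y1: "y1 = - (v \<cdot> a)"
  define y3 where y3: "y3 = - u"
  define x1 where x1: "x1 = - (v \<cdot> u)"
  define x2 where x2: "x2 = - (x1 \<cdot> a)"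
  define x3 where x3: "x3 = y1 \<cdot> v"
  define x4 where x4: "x4 = x1 \<cdot> v"
  define x5 where x5: "x5 = x2 \<cdot> y3"
  \<comment> \<open>These depths suffice: \<open>U 5\<close> is orthogonal to \<open>U 4\<close> and
    to itself, so within x1, ..., x5, y1 only (x1, y1) needs computation.\<close>
  have y1_in: "y1 \<in> U 4" unfolding y1 by (intro U_closed(3) vx_in[OF ctx])
  have x1_in: "x1 \<in> U 4" unfolding x1 by (intro U_closed(3) vx_in[OF ctx])
  have x2_in: "x2 \<in> U 5" unfolding x2 by (rule U_closed(3), rule prd_in(1)[OF x1_in]) simp_all
  have x3_in: "x3 \<in> U 5" unfolding x3 by (rule prd_in(1)[OF y1_in]) simp_all
  have x4_in: "x4 \<in> U 5" unfolding x4 by (rule prd_in(1)[OF x1_in]) simp_all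
  have x5_in: "x5 \<in> U 5" unfolding x5 by (rule prd_in(1)[OF x2_in]) simp_all
  have ba: "b \<cdot> a = y3" unfolding y3 u by (rule prd_commute)
  have prds: "a \<cdot> b = - y3" "v \<cdot> y3 = x1" "v \<cdot> a = - y1" "v \<cdot> b = 0" "y3 \<cdot> a = 0" "y3 \<cdot> b = - v"
    using vb ua by (simp_all add: y3 u[symmetric] x1 y1 v[symmetric])
  have prds': "y3 \<cdot> v = - x1" "a \<cdot> v = y1" "b \<cdot> v = 0" "a \<cdot> y3 = 0" "b \<cdot> y3 = v"
    using prd_commute[of y3 v] prd_commute[of a v] prd_commute[of b v] prd_commute[of a y3]
      prd_commute[of b y3] prds by simp_all
  have yy: "\<lparr>y3, a\<rparr> = 0" "\<lparr>y3, b\<rparr> = 0" "\<lparr>v, b\<rparr> = 0" "\<lparr>v, a\<rparr> = 0" "\<lparr>v, y3\<rparr> = 0"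
    "\<lparr>y1, v\<rparr> = 0" "\<lparr>y1, a\<rparr> = 0" "\<lparr>y1, y3\<rparr> = 0" "\<lparr>y1, b\<rparr> = 0"
    using frm_prd_cyclic[of u b a] frm_prd_cyclic[of v a u] frm_prd_cyclic[of v a b] prds' ba
    by (simp_all add: y1 y3 u[symmetric] v)
      (simp_all add: u v)
  have x1y: "\<lparr>x1, y1\<rparr> = 1" "\<lparr>x1, v\<rparr> = 0" "\<lparr>x1, y3\<rparr> = 0" "\<lparr>x1, a\<rparr> = 0" "\<lparr>x1, b\<rparr> = 0"
    using frm_prd_cyclic[of v u a] frm_prd_cyclic[of v u b] frm_commute[of "v \<cdot> u" "v \<cdot> a"] kap ua
    by (simp_all add: x1 y1 y3 v[symmetric])
  have y1x1: "\<lparr>y1, x1\<rparr> = - 1" using frm_commute[of y1 x1] x1y by simp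
  have x2y: "\<lparr>x2, y1\<rparr> = 0" "\<lparr>x2, v\<rparr> = 1" "\<lparr>x2, y3\<rparr> = 0" "\<lparr>x2, a\<rparr> = 0" "\<lparr>x2, b\<rparr> = 0"
    using U_orth[OF x2_in y1_in] frm_prd_cyclic[of x1 a v] frm_prd_cyclic[of x1 a y3]
      frm_prd_cyclic[of x1 a b] prds prds' y1x1 frm_commute[of y3 x1] x1y
    by (simp_all add: x2)
  have x3y: "\<lparr>x3, y1\<rparr> = 0" "\<lparr>x3, v\<rparr> = 0" "\<lparr>x3, y3\<rparr> = 1" "\<lparr>x3, a\<rparr> = 0" "\<lparr>x3, b\<rparr> = 0"
    using frm_prd_cyclic[of y1 v y3] frm_prd_cyclic[of y1 v a] frm_prd_cyclic[of y1 v b] prds x1y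
    by (simp_all add: x3)
  have x4y: "\<lparr>x4, y1\<rparr> = 0" "\<lparr>x4, v\<rparr> = 0" "\<lparr>x4, y3\<rparr> = 0" "\<lparr>x4, a\<rparr> = 1" "\<lparr>x4, b\<rparr> = 0"
    using U_orth[OF x4_in y1_in] frm_prd_cyclic[of x1 v y3] frm_prd_cyclic[of x1 v a]
      frm_prd_cyclic[of x1 v b] prds y1x1
    by (simp_all add: x4)
  have x12: "\<lparr>x1, x2\<rparr> = 0" "\<lparr>x1, x3\<rparr> = 0" "\<lparr>x1, x4\<rparr> = 0" "\<lparr>x1, x5\<rparr> = 0"
    by (rule U_orth[OF x1_in x2_in] U_orth[OF x1_in x3_in] U_orth[OF x1_in x4_in] U_orth[OF x1_in x5_in], simp_all)+
  have x5y: "\<lparr>x5, y1\<rparr> = 0" "\<lparr>x5, v\<rparr> = 0" "\<lparr>x5, y3\<rparr> = 0" "\<lparr>x5, a\<rparr> = 0" "\<lparr>x5, b\<rparr> = 1"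
    using U_orth[OF x5_in y1_in] frm_prd_cyclic[of x2 y3 v] frm_prd_cyclic[of x2 y3 a]
      frm_prd_cyclic[of x2 y3 b] prds prds' x12 frm_commute[of v x2] x2y
    by (simp_all add: x5)
  have xx: "\<lparr>x, y\<rparr> = 0" if "x \<in> U 5" "y \<in> U 5" for x y
    using that by (rule U_orth) simp_all
  note xx' = xx[OF x2_in x3_in] xx[OF x2_in x4_in] xx[OF x2_in x5_in]
    xx[OF x3_in x4_in] xx[OF x3_in x5_in] xx[OF x4_in x5_in]
  note gram0 = ab yy x12 xx'
  note gram = gram0 gram0[THEN frm_eq_0_sym] x1y x2y x3y x4y x5y
  have gram_flip:
    "\<lparr>y1, x2\<rparr> = 0" "\<lparr>y1, x3\<rparr> = 0" "\<lparr>y1, x4\<rparr> = 0" "\<lparr>y1, x5\<rparr> = 0"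
    "\<lparr>v, x1\<rparr> = 0" "\<lparr>v, x3\<rparr> = 0" "\<lparr>v, x4\<rparr> = 0" "\<lparr>v, x5\<rparr> = 0"
    "\<lparr>y3, x1\<rparr> = 0" "\<lparr>y3, x2\<rparr> = 0" "\<lparr>y3, x4\<rparr> = 0" "\<lparr>y3, x5\<rparr> = 0"
    by (rule frm_eq_0_sym, rule x1y x2y x3y x4y x5y)+
  define B where "B = list_family [x1, x2, x3, x4, x5] [y1, v, y3, a, b]"
  have B: "B (Xi 1) = x1" "B (Xi 2) = x2" "B (Xi 3) = x3" "B (Xi 4) = x4" "B (Xi 5) = x5"
    "B (Yi 1) = y1" "B (Yi 2) = v" "B (Yi 3) = y3" "B (Yi 4) = a" "B (Yi 5) = b"
    by (simp_all add: B_def)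
  have i5: "{1..5::nat} = {1, 2, 3, 4, 5}" by auto
  have "gram_standard 5 B"
    unfolding gram_standard_def i5 by (simp add: B[unfolded One_nat_def] gram)
  then have basis: "standard_basis 5 B" using dim_UNIV_eq by (intro standard_basisI) simp_all
  \<comment> \<open>H indexes vectors of \<open>U 4\<close>, whose mutual products vanish, and K the
    remaining ones, whose products are explicit. Two of any three indices lie in the same class, and
    a rotation makes them the factors.\<close>
  define H where "H = {Xi 1, Xi 2, Xi 3, Xi 4, Xi 5, Yi 1}"
  define K where "K = {Yi 2, Yi 3, Yi 4, Yi 5}"
  define S where "S = {{Xi 2, Yi 3, Yi 5}, {Xi 3, Yi 4, Yi 5}, {Xi 1, Yi 2, Yi 4}, {Yi 1, Yi 2, Yi 3}}"
  have I: "basis_indices 5 = H \<union> K" unfolding basis_indices_5 H_def K_def by auto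
  have "\<forall>i\<in>H. B i \<in> U 4"
    unfolding H_def using x1_in y1_in x2_in x3_in x4_in x5_in U_mono[of _ 5 4]
    by (simp add: B[unfolded One_nat_def])
  then have H0: "B i \<cdot> B j = 0" if "i \<in> H" "j \<in> H" for i j
    using U_null[of "B i" 4 "B j" 4] that by simp
  have "\<forall>i\<in>K. \<forall>j\<in>K. \<forall>k\<in>H \<union> K. \<lparr>B i \<cdot> B j, B k\<rparr> = 0 \<or> {i, j, k} \<in> S"
    unfolding H_def K_def S_def
    by (simp add: B[unfolded One_nat_def] prds prds' ba gram gram_flip insert_commute)
  then have K0: "\<lparr>B i \<cdot> B j, B k\<rparr> = 0 \<or> {i, j, k} \<in> S" if "i \<in> K" "j \<in> K" "k \<in> H \<union> K" for i j k
    using that by blast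
  have triple: "\<lparr>B i \<cdot> B j, B k\<rparr> = 0 \<or> {i, j, k} \<in> S"
    if ijk: "i \<in> H \<union> K" "j \<in> H \<union> K" "k \<in> H \<union> K" for i j k
  proof -
    have eq: "{j, k, i} = {i, j, k}" "{k, i, j} = {i, j, k}" by auto
    have cyc: "\<lparr>B i \<cdot> B j, B k\<rparr> = \<lparr>B j \<cdot> B k, B i\<rparr>" "\<lparr>B i \<cdot> B j, B k\<rparr> = \<lparr>B k \<cdot> B i, B j\<rparr>"
      using frm_prd_cyclic[of "B i" "B j" "B k"] frm_prd_cyclic[of "B k" "B i" "B j"] by simp_all
    consider "i \<in> H" "j \<in> H" | "j \<in> H" "k \<in> H" | "k \<in> H" "i \<in> H"
      | "i \<in> K" "j \<in> K" | "j \<in> K" "k \<in> K" | "k \<in> K" "i \<in> K"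
      using ijk by blast
    then show ?thesis
    proof cases
      case 1 then show ?thesis using H0 by simp
    next
      case 2 then show ?thesis using H0 cyc(1) by simp
    next
      case 3 then show ?thesis using H0 cyc(2) by simp
    next
      case 4 then show ?thesis using K0 ijk by simp
    next
      case 5 then show ?thesis using K0[of j k i] ijk unfolding cyc(1) eq by simp
    next
      case 6 then show ?thesis using K0[of k i j] ijk unfolding cyc(2) eq by simp
    qed
  qed
  have listed: "\<forall>(i, j, k, r)\<in>P10_2_7. \<lparr>B i \<cdot> B j, B k\<rparr> = r"
    unfolding P10_2_7_def using x5y x3y frm_prd_cyclic[of x2 y3 b] frm_prd_cyclic[of x3 a b]
      frm_prd_cyclic[of x1 v a] frm_prd_cyclic[of y1 v y3] prds x1y y1x1
      frm_commute[of y3 x3] frm_commute[of v x2] x2y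
    by (simp add: B[unfolded One_nat_def])
  have "\<forall>i\<in>basis_indices 5. \<forall>j\<in>basis_indices 5. \<forall>k\<in>basis_indices 5.
      (\<forall>(i', j', k', r)\<in>(P10_2_7 :: 'a presentation). {i, j, k} \<noteq> {i', j', k'}) \<longrightarrow> \<lparr>B i \<cdot> B j, B k\<rparr> = 0"
  proof (intro ballI impI)
    fix i j k
    assume "i \<in> basis_indices 5" "j \<in> basis_indices 5" "k \<in> basis_indices 5"
      and "\<forall>(i', j', k', r)\<in>(P10_2_7 :: 'a presentation). {i, j, k} \<noteq> {i', j', k'}"
    then have "{i, j, k} \<notin> S" unfolding S_def P10_2_7_def by simp
    then show "\<lparr>B i \<cdot> B j, B k\<rparr> = 0"
      using triple \<open>i \<in> _\<close> \<open>j \<in> _\<close> \<open>k \<in> _\<close> unfolding I by blast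
  qed
  then show ?thesis unfolding has_presentation_def using basis listed by blast
qed

section \<open>From the presentation back to the type\<close>

fun dual_index :: "basis_index \<Rightarrow> basis_index" where
  "dual_index (Xi i) = Yi i"
| "dual_index (Yi i) = Xi i"

lemma dual_index_in [simp]: "dual_index i \<in> basis_indices n \<longleftrightarrow> i \<in> basis_indices n"
  by (cases i) (auto simp: basis_indices_def)

context symplectic_alternating_algebra
begin

lemma standard_basis_gram: "standard_basis n b \<Longrightarrow> gram_standard n b"
  unfolding standard_basis_def gram_standard_def by blast

lemma standard_basis_ext:
  assumes "standard_basis n b" "\<And>i. i \<in> basis_indices n \<Longrightarrow> \<lparr>x, b i\<rparr> = \<lparr>y, b i\<rparr>"
  shows "x = y"
proof (rule frm_ext)
  fix z
  have "z \<in> span (b ` basis_indices n)" using assms(1) unfolding standard_basis_def by blast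
  then have "\<lparr>z, x - y\<rparr> = 0"
  proof (rule frm_eq_0_span)
    fix s assume "s \<in> b ` basis_indices n"
    then have "\<lparr>x - y, s\<rparr> = 0" using assms(2) by auto
    then show "\<lparr>s, x - y\<rparr> = 0" by (rule frm_eq_0_sym)
  qed
  then have "\<lparr>x - y, z\<rparr> = 0" by (rule frm_eq_0_sym)
  then show "\<lparr>x, z\<rparr> = \<lparr>y, z\<rparr>" by simp
qed

lemma frm_dual_vector_left:
  assumes "standard_basis n b" "i \<in> basis_indices n" "j \<in> basis_indices n"
  shows "\<lparr>dual_vector b i, b j\<rparr> = (if i = j then - 1 else 0)"
  using frm_dual_vector[OF standard_basis_gram[OF assms(1)] assms(3,2)]
    frm_commute[of "dual_vector b i" "b j"] by simp

lemma standard_basis_expansion: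
  assumes "standard_basis n b"
  shows "x = (\<Sum>i\<in>basis_indices n. \<lparr>x, dual_vector b i\<rparr> \<star> b i)"
proof (rule standard_basis_ext[OF assms])
  fix k assume k: "k \<in> basis_indices n"
  let ?k = "dual_index k"
  \<comment> \<open>Up to sign every basis vector is a dual vector, so testing against the dual
    family tests against the basis.\<close>
  have bk: "b k = dual_vector b ?k \<or> b k = - dual_vector b ?k" by (cases k) simp_all
  have "(\<Sum>i\<in>basis_indices n. \<lparr>x, dual_vector b i\<rparr> * \<lparr>b i, dual_vector b ?k\<rparr>) =
    (\<Sum>i\<in>basis_indices n. if i = ?k then \<lparr>x, dual_vector b i\<rparr> else 0)"
    using frm_dual_vector[OF standard_basis_gram[OF assms]] k by (intro sum.cong) auto
  also have "\<dots> = \<lparr>x, dual_vector b ?k\<rparr>" using k finite_basis_indices by simp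
  finally have *: "(\<Sum>i\<in>basis_indices n. \<lparr>x, dual_vector b i\<rparr> * \<lparr>b i, dual_vector b ?k\<rparr>) =
    \<lparr>x, dual_vector b ?k\<rparr>" .
  show "\<lparr>x, b k\<rparr> = \<lparr>\<Sum>i\<in>basis_indices n. \<lparr>x, dual_vector b i\<rparr> \<star> b i, b k\<rparr>"
    using bk by (elim disjE) (simp_all only: frm_sum frm_simps mult_minus_right sum_negf *)
qed

lemma frm_prd_eq_0_span:
  assumes "x \<in> span A" "y \<in> span B" "\<And>s t. s \<in> A \<Longrightarrow> t \<in> B \<Longrightarrow> \<lparr>s \<cdot> t, z\<rparr> = 0"
  shows "\<lparr>x \<cdot> y, z\<rparr> = 0"
proof -
  have "\<lparr>s \<cdot> y, z\<rparr> = 0" if s: "s \<in> A" for s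
  proof -
    have "span B \<subseteq> {y. \<lparr>s \<cdot> y, z\<rparr> = 0}"
      using assms(3) s by (intro span_minimal) (auto simp: subspace_def)
    then show ?thesis using assms(2) by blast
  qed
  then have "span A \<subseteq> {x. \<lparr>x \<cdot> y, z\<rparr> = 0}"
    by (intro span_minimal) (auto simp: subspace_def)
  then show ?thesis using assms(1) by blast
qed

text \<open>\<open>has_presentation\<close> with the basis exposed, since an isomorphism is built by
  matching two such bases.\<close>

definition presents :: "nat \<Rightarrow> 'k presentation \<Rightarrow> (basis_index \<Rightarrow> 'v) \<Rightarrow> bool" where
  "presents n P b \<longleftrightarrow> standard_basis n b \<and>
     (\<forall>(i, j, k, r)\<in>P. \<lparr>b i \<cdot> b j, b k\<rparr> = r) \<and>
     (\<forall>i\<in>basis_indices n. \<forall>j\<in>basis_indices n. \<forall>k\<in>basis_indices n.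
        (\<forall>(i', j', k', r)\<in>P. {i, j, k} \<noteq> {i', j', k'}) \<longrightarrow> \<lparr>b i \<cdot> b j, b k\<rparr> = 0)"

lemma has_presentation_iff: "has_presentation n P \<longleftrightarrow> (\<exists>b. presents n P b)"
  unfolding has_presentation_def presents_def ..

end

text \<open>
  The weight of a basis vector is the largest $k$ such that $L^k$ contains it. Dual basis vectors have
  weights adding up to 8, while any two entries of a non-zero triple have weights adding up to at most 7;
  so multiplication raises the weight.
\<close>

definition weight :: "basis_index \<Rightarrow> nat" where
  "weight = list_family [4, 5, 6, 7, 7] [4, 3, 2, 1, 1]"

lemma weight_simps [simp]:
  "weight (Xi 1) = 4" "weight (Xi 2) = 5" "weight (Xi 3) = 6" "weight (Xi 4) = 7" "weight (Xi 5) = 7"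
  "weight (Yi 1) = 4" "weight (Yi 2) = 3" "weight (Yi 3) = 2" "weight (Yi 4) = 1" "weight (Yi 5) = 1"
  "weight (Xi (Suc 0)) = 4" "weight (Yi (Suc 0)) = 4"
  by (simp_all add: weight_def)

lemma weight_dual_index: "i \<in> basis_indices 5 \<Longrightarrow> weight (dual_index i) + weight i = 8"
  unfolding basis_indices_5 by auto

lemma insert3_eq_cases:
  assumes "{i, j, k} = {i', j', k'}" "i' \<noteq> j'" "j' \<noteq> k'" "i' \<noteq> k'"
  obtains "i = i'" "j = j'" "k = k'" | "i = i'" "j = k'" "k = j'"
  | "i = j'" "j = i'" "k = k'" | "i = j'" "j = k'" "k = i'"
  | "i = k'" "j = i'" "k = j'" | "i = k'" "j = j'" "k = i'"
proof -
  have mem: "i = i' \<or> i = j' \<or> i = k'" "j = i' \<or> j = j' \<or> j = k'" "k = i' \<or> k = j' \<or> k = k'"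
    using assms(1) by blast+
  have "card {i, j, k} = 3" using assms by simp
  then have "i \<noteq> j" "j \<noteq> k" "i \<noteq> k" by (auto simp: card_insert_if split: if_splits)
  with mem show ?thesis
    by (elim disjE) (simp_all add: that)
qed

lemma P10_2_7_distinct: "(i, j, k, r) \<in> P10_2_7 \<Longrightarrow> i \<noteq> j \<and> j \<noteq> k \<and> i \<noteq> k"
  by (auto simp: P10_2_7_def)

text \<open>Both bounds are read off the four triples. The second concerns the two that contain y_5:
  next to y_5 and the vector x_2 or x_3 stands y_3 or y_4, of weight at most 2.\<close>

lemma weight_pair:
  assumes P: "(i', j', k', r) \<in> P10_2_7" and eq: "{i, j, k} = {i', j', k'}"
  shows "weight i + weight k \<le> 7" "k = Yi 5 \<Longrightarrow> 4 \<le> weight i \<Longrightarrow> weight j \<le> 2"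
proof -
  have w: "weight i' + weight j' \<le> 7 \<and> weight j' + weight k' \<le> 7 \<and> weight i' + weight k' \<le> 7"
    and y: "i' \<noteq> Yi 5 \<and> j' \<noteq> Yi 5 \<and> (k' = Yi 5 \<longrightarrow> weight j' \<le> 2 \<and> (4 \<le> weight j' \<longrightarrow> weight i' \<le> 2))"
    using P unfolding P10_2_7_def by auto
  show "weight i + weight k \<le> 7"
    using eq P10_2_7_distinct[OF P] w by (elim insert3_eq_cases) auto
  show "k = Yi 5 \<Longrightarrow> 4 \<le> weight i \<Longrightarrow> weight j \<le> 2"
    using eq P10_2_7_distinct[OF P] y by (elim insert3_eq_cases) auto
qed

context symplectic_alternating_algebra
begin

context
  fixes b
  assumes pres: "presents 5 P10_2_7 b"
begin

lemma basis: "standard_basis 5 b" using pres unfolding presents_def by blast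

lemma triple_eq_0:
  assumes "i \<in> basis_indices 5" "j \<in> basis_indices 5" "k \<in> basis_indices 5"
    and "\<And>i' j' k' r. (i', j', k', r) \<in> (P10_2_7 :: 'k presentation) \<Longrightarrow> {i, j, k} \<noteq> {i', j', k'}"
  shows "\<lparr>b i \<cdot> b j, b k\<rparr> = 0"
proof -
  have "\<forall>(i', j', k', r)\<in>(P10_2_7 :: 'k presentation). {i, j, k} \<noteq> {i', j', k'}" using assms(4) by blast
  then show ?thesis using pres assms(1-3) unfolding presents_def by blast
qed

definition weight_span :: "nat \<Rightarrow> 'v set" where
  "weight_span k = span (b ` {i \<in> basis_indices 5. k \<le> weight i})"

text \<open>The coefficient at \<open>b i\<close> is up to sign the pairing with the vector at
  \<open>dual_index i\<close>. As dual weights add up to 8, weight below k at \<open>i\<close> means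
  weight at least 9 - k at its dual.\<close>

lemma in_weight_spanI:
  assumes "\<And>m. m \<in> basis_indices 5 \<Longrightarrow> 9 \<le> weight m + k \<Longrightarrow> \<lparr>z, b m\<rparr> = 0"
  shows "z \<in> weight_span k"
proof -
  let ?I = "basis_indices 5"
  have coeff: "\<lparr>z, dual_vector b i\<rparr> = 0" if i: "i \<in> ?I" "\<not> k \<le> weight i" for i
  proof -
    have "\<lparr>z, b (dual_index i)\<rparr> = 0"
      using i weight_dual_index[OF i(1)] by (intro assms) simp_all
    then show ?thesis by (cases i) simp_all
  qed
  have "z = (\<Sum>i\<in>?I. \<lparr>z, dual_vector b i\<rparr> \<star> b i)" by (rule standard_basis_expansion[OF basis])
  also have "\<dots> = (\<Sum>i\<in>{i\<in>?I. k \<le> weight i}. \<lparr>z, dual_vector b i\<rparr> \<star> b i)"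
    using coeff finite_basis_indices by (intro sum.mono_neutral_right) auto
  also have "\<dots> \<in> weight_span k"
    unfolding weight_span_def by (intro span_sum span_scale span_base) auto
  finally show ?thesis .
qed

text \<open>The criterion tests only \<open>m\<close> with \<open>8 \<le> weight m + k\<close>,
  whereas two entries of a non-zero triple have total weight at most 7.\<close>

lemma weight_span_prd:
  assumes x: "x \<in> weight_span k" shows "x \<cdot> y \<in> weight_span (Suc k)"
proof (rule in_weight_spanI)
  fix m assume m: "m \<in> basis_indices 5" "9 \<le> weight m + Suc k"
  have y: "y \<in> span (b ` basis_indices 5)" using basis unfolding standard_basis_def by blast
  show "\<lparr>x \<cdot> y, b m\<rparr> = 0"
    using x[unfolded weight_span_def] y
  proof (rule frm_prd_eq_0_span)
    fix s t assume "s \<in> b ` {i \<in> basis_indices 5. k \<le> weight i}" "t \<in> b ` basis_indices 5"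
    then obtain i j where ij: "i \<in> basis_indices 5" "k \<le> weight i" "j \<in> basis_indices 5"
      and st: "s = b i" "t = b j" by blast
    show "\<lparr>s \<cdot> t, b m\<rparr> = 0"
      unfolding st
    proof (rule triple_eq_0[OF ij(1,3) m(1)], rule notI)
      fix i' j' k' and r :: 'k assume "(i', j', k', r) \<in> P10_2_7" "{i, j, m} = {i', j', k'}"
      then have "weight i + weight m \<le> 7" by (rule weight_pair(1))
      then show False using m(2) ij(2) by simp
    qed
  qed
qed

lemma U_subset_weight_span: "1 \<le> k \<Longrightarrow> U k \<subseteq> weight_span k"
proof (induction k rule: dec_induct)
  case base
  show ?case
  proof (rule subsetI, rule in_weight_spanI)
    fix x m assume "m \<in> basis_indices 5" "9 \<le> weight m + 1"
    then show "\<lparr>x, b m\<rparr> = 0" unfolding basis_indices_5 by auto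
  qed
next
  case (step k)
  show ?case
  proof (rule U_Suc_least[OF step.hyps(1)])
    show "subspace (weight_span (Suc k))" unfolding weight_span_def by (rule subspace_span)
    show "x \<cdot> y \<in> weight_span (Suc k)" if "x \<in> U k" for x y
      using that step.IH by (intro weight_span_prd) blast
  qed
qed

lemma U8_eq: "U 8 = {0}"
proof -
  have "{i \<in> basis_indices 5. 8 \<le> weight i} = {}" unfolding basis_indices_5 by auto
  then have "weight_span 8 = span (b ` {})" unfolding weight_span_def by (simp only:)
  then have "weight_span 8 = {0}" by simp
  then show ?thesis using U_subset_weight_span[of 8] U_closed(5)[of 8] by auto
qed

text \<open>Pairing with y_5 is the witness for both inequalities: it vanishes on \<open>U 4\<close>
  times \<open>U 3\<close>, but not on x_5, which lies in \<open>U 7\<close> and in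
  \<open>U 5\<close> times \<open>U 2\<close>.\<close>

lemma U4_U3_perp:
  assumes "z \<in> subspace_prod (U 4) (U 3)" shows "\<lparr>z, b (Yi 5)\<rparr> = 0"
proof (rule frm_eq_0_span[OF assms[unfolded subspace_prod_def]], clarify)
  fix x y assume x: "x \<in> U 4" and y: "y \<in> U 3"
  have "x \<in> weight_span 4" by (rule subsetD[OF U_subset_weight_span x]) simp
  moreover have "y \<in> weight_span 3" by (rule subsetD[OF U_subset_weight_span y]) simp
  ultimately show "\<lparr>x \<cdot> y, b (Yi 5)\<rparr> = 0"
    unfolding weight_span_def
  proof (rule frm_prd_eq_0_span)
    fix s t assume "s \<in> b ` {i \<in> basis_indices 5. 4 \<le> weight i}" "t \<in> b ` {i \<in> basis_indices 5. 3 \<le> weight i}"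
    then obtain i j where ij: "i \<in> basis_indices 5" "4 \<le> weight i" "j \<in> basis_indices 5" "3 \<le> weight j"
      and st: "s = b i" "t = b j" by blast
    have y5: "Yi 5 \<in> basis_indices 5" unfolding basis_indices_5 by simp
    show "\<lparr>s \<cdot> t, b (Yi 5)\<rparr> = 0"
      unfolding st
    proof (rule triple_eq_0[OF ij(1,3) y5], rule notI)
      fix i' j' k' and r :: 'k assume P: "(i', j', k', r) \<in> P10_2_7" and eq: "{i, j, Yi 5} = {i', j', k'}"
      have "weight j \<le> 2" by (rule weight_pair(2)[OF P eq refl ij(2)])
      then show False using ij(4) by simp
    qed
  qed
qed

lemma listed_triples:
  "\<lparr>b (Xi 2) \<cdot> b (Yi 3), b (Yi 5)\<rparr> = 1" "\<lparr>b (Xi 3) \<cdot> b (Yi 4), b (Yi 5)\<rparr> = 1"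
  "\<lparr>b (Xi 1) \<cdot> b (Yi 2), b (Yi 4)\<rparr> = 1" "\<lparr>b (Yi 1) \<cdot> b (Yi 2), b (Yi 3)\<rparr> = 1"
proof -
  have *: "\<forall>(i, j, k, r)\<in>P10_2_7. \<lparr>b i \<cdot> b j, b k\<rparr> = r"
    by (rule pres[unfolded presents_def, THEN conjunct2, THEN conjunct1])
  show "\<lparr>b (Xi 2) \<cdot> b (Yi 3), b (Yi 5)\<rparr> = 1" "\<lparr>b (Xi 3) \<cdot> b (Yi 4), b (Yi 5)\<rparr> = 1"
  "\<lparr>b (Xi 1) \<cdot> b (Yi 2), b (Yi 4)\<rparr> = 1" "\<lparr>b (Yi 1) \<cdot> b (Yi 2), b (Yi 3)\<rparr> = 1"
    using bspec[OF *, of "(Xi 2, Yi 3, Yi 5, 1)"] bspec[OF *, of "(Xi 3, Yi 4, Yi 5, 1)"]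
      bspec[OF *, of "(Xi 1, Yi 2, Yi 4, 1)"] bspec[OF *, of "(Yi 1, Yi 2, Yi 3, 1)"]
    by (simp_all add: P10_2_7_def)
qed

text \<open>A product pairing non-trivially with at most one basis vector is a multiple of the dual
  vector there; the minus sign occurs because a dual vector in the left entry pairs to -1.\<close>

lemma product_eq_dual_vector:
  assumes ijm: "i \<in> basis_indices 5" "j \<in> basis_indices 5" "m \<in> basis_indices 5"
    and r: "\<lparr>b i \<cdot> b j, b m\<rparr> = r"
    and other: "\<forall>k\<in>basis_indices 5. k \<noteq> m \<longrightarrow> (\<forall>(i', j', k', r)\<in>(P10_2_7 :: 'k presentation).
      {i, j, k} \<noteq> {i', j', k'})"
  shows "b i \<cdot> b j = (- r) \<star> dual_vector b m"
proof (rule standard_basis_ext[OF basis])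
  fix k assume k: "k \<in> basis_indices 5"
  have d: "\<lparr>(- r) \<star> dual_vector b m, b k\<rparr> = (if m = k then r else 0)"
    unfolding frm_simps frm_dual_vector_left[OF basis ijm(3) k] by simp
  have t: "\<lparr>b i \<cdot> b j, b k\<rparr> = 0" if km: "k \<noteq> m"
  proof (rule triple_eq_0[OF ijm(1,2) k])
    fix i' j' k' and s :: 'k assume P: "(i', j', k', s) \<in> P10_2_7"
    show "{i, j, k} \<noteq> {i', j', k'}"
      using bspec[OF mp[OF bspec[OF other k] km] P] unfolding prod.case .
  qed
  show "\<lparr>b i \<cdot> b j, b k\<rparr> = \<lparr>(- r) \<star> dual_vector b m, b k\<rparr>"
  proof (cases "m = k")
    case True
    then show ?thesis using r unfolding d by simp
  next
    case False
    then show ?thesis unfolding d using t by simp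
  qed
qed

text \<open>Each of these pairs occurs in exactly one listed triple, so its product is a single
  basis vector up to sign.\<close>

lemma products:
  "b (Yi 4) \<cdot> b (Yi 5) = - b (Yi 3)" "b (Yi 3) \<cdot> b (Yi 5) = - b (Yi 2)"
  "b (Yi 2) \<cdot> b (Yi 3) = b (Xi 1)" "b (Yi 2) \<cdot> b (Yi 4) = - b (Yi 1)"
  "b (Xi 1) \<cdot> b (Yi 2) = b (Xi 4)" "b (Xi 1) \<cdot> b (Yi 4) = - b (Xi 2)"
  "b (Xi 2) \<cdot> b (Yi 3) = b (Xi 5)" "b (Xi 2) \<cdot> b (Yi 5) = - b (Xi 3)"
  "b (Xi 3) \<cdot> b (Yi 4) = b (Xi 5)" "b (Xi 3) \<cdot> b (Yi 5) = - b (Xi 4)"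
proof -
  note cyc = frm_prd_cyclic[of "b (Xi 3)" "b (Yi 4)" "b (Yi 5)"] frm_prd_cyclic[of "b (Xi 2)" "b (Yi 3)" "b (Yi 5)"]
    frm_prd_cyclic[of "b (Xi 1)" "b (Yi 2)" "b (Yi 4)"] frm_prd_cyclic[of "b (Yi 1)" "b (Yi 2)" "b (Yi 3)"]
  note swap = frm_prd_swap[of "b (Xi 1)" "b (Yi 4)" "b (Yi 2)"] frm_prd_swap[of "b (Xi 2)" "b (Yi 5)" "b (Yi 3)"]
    frm_prd_swap[of "b (Xi 3)" "b (Yi 5)" "b (Yi 4)"]
  have T: "\<lparr>b (Yi 4) \<cdot> b (Yi 5), b (Xi 3)\<rparr> = 1" "\<lparr>b (Yi 3) \<cdot> b (Yi 5), b (Xi 2)\<rparr> = 1"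
    "\<lparr>b (Yi 2) \<cdot> b (Yi 3), b (Yi 1)\<rparr> = 1" "\<lparr>b (Yi 2) \<cdot> b (Yi 4), b (Xi 1)\<rparr> = 1"
    "\<lparr>b (Xi 1) \<cdot> b (Yi 4), b (Yi 2)\<rparr> = - 1" "\<lparr>b (Xi 2) \<cdot> b (Yi 5), b (Yi 3)\<rparr> = - 1"
    "\<lparr>b (Xi 3) \<cdot> b (Yi 5), b (Yi 4)\<rparr> = - 1"
    by (simp_all only: cyc[symmetric] swap listed_triples)
  have I: "Xi 1 \<in> basis_indices 5" "Xi 2 \<in> basis_indices 5" "Xi 3 \<in> basis_indices 5"
    "Yi 1 \<in> basis_indices 5" "Yi 2 \<in> basis_indices 5" "Yi 3 \<in> basis_indices 5"
    "Yi 4 \<in> basis_indices 5" "Yi 5 \<in> basis_indices 5"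
    unfolding basis_indices_5 by simp_all
  have "b (Yi 4) \<cdot> b (Yi 5) = (- 1) \<star> dual_vector b (Xi 3)"
    by (rule product_eq_dual_vector[OF I(7,8,3) T(1)], unfold P10_2_7_def basis_indices_5,
        simp only: ball_simps prod.case, simp add: set_eq_subset)
  then show "b (Yi 4) \<cdot> b (Yi 5) = - b (Yi 3)" by simp
  have "b (Yi 3) \<cdot> b (Yi 5) = (- 1) \<star> dual_vector b (Xi 2)"
    by (rule product_eq_dual_vector[OF I(6,8,2) T(2)], unfold P10_2_7_def basis_indices_5,
        simp only: ball_simps prod.case, simp add: set_eq_subset)
  then show "b (Yi 3) \<cdot> b (Yi 5) = - b (Yi 2)" by simp
  have "b (Yi 2) \<cdot> b (Yi 3) = (- 1) \<star> dual_vector b (Yi 1)"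
    by (rule product_eq_dual_vector[OF I(5,6,4) T(3)], unfold P10_2_7_def basis_indices_5,
        simp only: ball_simps prod.case, simp add: set_eq_subset)
  then show "b (Yi 2) \<cdot> b (Yi 3) = b (Xi 1)" by simp
  have "b (Yi 2) \<cdot> b (Yi 4) = (- 1) \<star> dual_vector b (Xi 1)"
    by (rule product_eq_dual_vector[OF I(5,7,1) T(4)], unfold P10_2_7_def basis_indices_5,
        simp only: ball_simps prod.case, simp add: set_eq_subset)
  then show "b (Yi 2) \<cdot> b (Yi 4) = - b (Yi 1)" by simp
  have "b (Xi 1) \<cdot> b (Yi 2) = (- 1) \<star> dual_vector b (Yi 4)"
    by (rule product_eq_dual_vector[OF I(1,5,7) listed_triples(3)], unfold P10_2_7_def basis_indices_5,
        simp only: ball_simps prod.case, simp add: set_eq_subset)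
  then show "b (Xi 1) \<cdot> b (Yi 2) = b (Xi 4)" by simp
  have "b (Xi 1) \<cdot> b (Yi 4) = (- (- 1)) \<star> dual_vector b (Yi 2)"
    by (rule product_eq_dual_vector[OF I(1,7,5) T(5)], unfold P10_2_7_def basis_indices_5,
        simp only: ball_simps prod.case, simp add: set_eq_subset)
  then show "b (Xi 1) \<cdot> b (Yi 4) = - b (Xi 2)" by simp
  have "b (Xi 2) \<cdot> b (Yi 3) = (- 1) \<star> dual_vector b (Yi 5)"
    by (rule product_eq_dual_vector[OF I(2,6,8) listed_triples(1)], unfold P10_2_7_def basis_indices_5,
        simp only: ball_simps prod.case, simp add: set_eq_subset)
  then show "b (Xi 2) \<cdot> b (Yi 3) = b (Xi 5)" by simp
  have "b (Xi 2) \<cdot> b (Yi 5) = (- (- 1)) \<star> dual_vector b (Yi 3)"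
    by (rule product_eq_dual_vector[OF I(2,8,6) T(6)], unfold P10_2_7_def basis_indices_5,
        simp only: ball_simps prod.case, simp add: set_eq_subset)
  then show "b (Xi 2) \<cdot> b (Yi 5) = - b (Xi 3)" by simp
  have "b (Xi 3) \<cdot> b (Yi 4) = (- 1) \<star> dual_vector b (Yi 5)"
    by (rule product_eq_dual_vector[OF I(3,7,8) listed_triples(2)], unfold P10_2_7_def basis_indices_5,
        simp only: ball_simps prod.case, simp add: set_eq_subset)
  then show "b (Xi 3) \<cdot> b (Yi 4) = b (Xi 5)" by simp
  have "b (Xi 3) \<cdot> b (Yi 5) = (- (- 1)) \<star> dual_vector b (Yi 4)"
    by (rule product_eq_dual_vector[OF I(3,8,7) T(7)], unfold P10_2_7_def basis_indices_5,
        simp only: ball_simps prod.case, simp add: set_eq_subset)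
  then show "b (Xi 3) \<cdot> b (Yi 5) = - b (Xi 4)" by simp
qed

lemma dim_UNIV_10: "dim UNIV = 10"
proof -
  have "card (b ` basis_indices 5) = dim UNIV"
    using basis unfolding standard_basis_def by (intro basis_card_eq_dim) auto
  then show ?thesis
    using basis unfolding standard_basis_def by (simp add: card_image card_basis_indices)
qed

text \<open>The lower bound for the powers, matching the upper bound from weights: starting at y_4
  and y_5, each vector is up to sign a product with a factor one power higher up.\<close>

lemma basis_vectors_in_U:
  "b (Yi 3) \<in> U 2" "b (Yi 2) \<in> U 3" "b (Yi 1) \<in> U 4" "b (Xi 1) \<in> U 4"
  "b (Xi 2) \<in> U 5" "b (Xi 3) \<in> U 6" "b (Xi 4) \<in> U 7" "b (Xi 5) \<in> U 7"
proof -
  have neg: "x \<in> U k" if "- x \<in> U k" for x k using U_closed(3)[OF that] by simp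
  show y3: "b (Yi 3) \<in> U 2"
    by (rule neg, fold products(1), rule prd_in(1)[of _ 1]) simp_all
  show y2: "b (Yi 2) \<in> U 3"
    by (rule neg, fold products(2), rule prd_in(1)[OF y3]) simp_all
  show "b (Yi 1) \<in> U 4"
    by (rule neg, fold products(4), rule prd_in(1)[OF y2]) simp_all
  show x1: "b (Xi 1) \<in> U 4"
    by (fold products(3), rule prd_in(1)[OF y2]) simp_all
  show x2: "b (Xi 2) \<in> U 5"
    by (rule neg, fold products(6), rule prd_in(1)[OF x1]) simp_all
  show x3: "b (Xi 3) \<in> U 6"
    by (rule neg, fold products(8), rule prd_in(1)[OF x2]) simp_all
  show "b (Xi 4) \<in> U 7"
    by (rule neg, fold products(10), rule prd_in(1)[OF x3]) simp_all
  show "b (Xi 5) \<in> U 7"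
    by (fold products(9), rule prd_in(1)[OF x3]) simp_all
qed

lemma frm_x5_y5: "\<lparr>b (Xi 5), b (Yi 5)\<rparr> = 1"
  using standard_basis_gram[OF basis] unfolding gram_standard_def by simp

text \<open>All basis vectors except y_4 and y_5 lie in \<open>U 2\<close>, so a vector orthogonal
  to \<open>U 2\<close> has coefficients only at x_4 and x_5.\<close>

lemma center_eq_span: "center = span {b (Xi 4), b (Xi 5)}"
proof
  have "x \<in> center" if "x \<in> U 7" for x
    using prd_in_U(1)[of 7 x] that U8_eq by (simp add: center_def)
  moreover have "subspace center" unfolding center_eq_perp by (rule subspace_perp)
  ultimately show "span {b (Xi 4), b (Xi 5)} \<subseteq> center"
    using basis_vectors_in_U(7,8) by (intro span_minimal) auto
  show "center \<subseteq> span {b (Xi 4), b (Xi 5)}"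
  proof
    fix z assume "z \<in> center"
    then have z: "\<lparr>z, w\<rparr> = 0" if "w \<in> U k" "2 \<le> k" for w k
      using U_mono[OF that] unfolding center_eq_perp perp_def by blast
    have z0: "\<lparr>z, b (Yi 3)\<rparr> = 0" "\<lparr>z, b (Yi 2)\<rparr> = 0" "\<lparr>z, b (Yi 1)\<rparr> = 0" "\<lparr>z, b (Xi 1)\<rparr> = 0"
      "\<lparr>z, b (Xi 2)\<rparr> = 0" "\<lparr>z, b (Xi 3)\<rparr> = 0" "\<lparr>z, b (Xi 4)\<rparr> = 0" "\<lparr>z, b (Xi 5)\<rparr> = 0"
      by (rule z, rule basis_vectors_in_U, simp)+
    have "z = (\<Sum>i\<in>basis_indices 5. \<lparr>z, dual_vector b i\<rparr> \<star> b i)"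
      by (rule standard_basis_expansion[OF basis])
    also have "\<dots> = (\<Sum>i\<in>{Xi 4, Xi 5}. \<lparr>z, dual_vector b i\<rparr> \<star> b i)"
      unfolding basis_indices_5 using z0 by (intro sum.mono_neutral_right) auto
    also have "\<dots> \<in> span {b (Xi 4), b (Xi 5)}"
      by (intro span_sum span_scale span_base) auto
    finally show "z \<in> span {b (Xi 4), b (Xi 5)}" .
  qed
qed

lemma dim_center_2: "dim center = 2"
proof -
  have I: "{Xi 4, Xi 5} \<subseteq> basis_indices 5" unfolding basis_indices_5 by simp
  have "inj_on b (basis_indices 5)" and ind: "independent (b ` basis_indices 5)"
    using basis unfolding standard_basis_def by blast+
  then have "card (b ` {Xi 4, Xi 5}) = card {Xi 4, Xi 5}"
    using I by (intro card_image) (rule inj_on_subset)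
  moreover have "independent (b ` {Xi 4, Xi 5})"
    using ind by (rule independent_mono) (intro image_mono I)
  ultimately show ?thesis
    unfolding center_eq_span using dim_span_eq_card_independent[of "b ` {Xi 4, Xi 5}"] by simp
qed

text \<open>The center is orthogonal to \<open>U 2\<close> and contained in it.\<close>

lemma isotropic_center: "isotropic center"
  unfolding isotropic_def
proof (intro ballI)
  fix x y assume x: "x \<in> center" and y: "y \<in> center"
  have 45: "b (Xi 4) \<in> U 2" "b (Xi 5) \<in> U 2" by (rule U_mono, rule basis_vectors_in_U, simp)+
  have "span {b (Xi 4), b (Xi 5)} \<subseteq> U 2" using 45 subspace_U by (intro span_minimal) auto
  then show "\<lparr>x, y\<rparr> = 0" using x y center_eq_span unfolding center_eq_perp perp_def by blast
qed

lemma presents_type_10_2_7: "type_10_2_7"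
proof -
  have x5: "b (Xi 5) \<in> U 7" by (rule basis_vectors_in_U)
  have x5_notin: "b (Xi 5) \<notin> subspace_prod (U 4) (U 3)"
    using U4_U3_perp[of "b (Xi 5)"] frm_x5_y5 by auto
  have "b (Xi 2) \<cdot> b (Yi 3) \<in> subspace_prod (U 5) (U 2)"
    unfolding subspace_prod_def using basis_vectors_in_U(1,5) by (intro span_base) blast
  then have x5_in: "b (Xi 5) \<in> subspace_prod (U 5) (U 2)" unfolding products(7) .
  have "nilpotence_class = 7"
    unfolding nilpotence_class_def
  proof (rule Least_equality)
    show "U (7 + 1) = {0}" using U8_eq by simp
    fix k assume k: "U (k + 1) = {0}"
    show "7 \<le> k"
    proof (rule ccontr)
      assume "\<not> 7 \<le> k"
      then have "b (Xi 5) \<in> U (k + 1)" by (intro U_mono[OF x5]) simp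
      then have "b (Xi 5) = 0" unfolding k by (rule singletonD)
      then show False using frm_x5_y5 by simp
    qed
  qed
  moreover have "nilpotent" unfolding nilpotent_def using U8_eq by (intro exI[of _ 7]) simp
  ultimately show ?thesis
    unfolding type_10_2_7_def
    using dim_UNIV_10 isotropic_center dim_center_2 x5 x5_in x5_notin by blast
qed

end

end

lemma type_10_2_7_iff_has_presentation:
  assumes "symplectic_alternating_algebra L"
  shows "symplectic_alternating_algebra.type_10_2_7 L \<longleftrightarrow>
    symplectic_alternating_algebra.has_presentation L 5 P10_2_7"
proof -
  interpret symplectic_alternating_algebra L by (rule assms)
  show ?thesis
  proof
    assume "type_10_2_7"
    then interpret saa_10_2_7 L by unfold_locales
    show "has_presentation 5 P10_2_7" by (rule has_presentation)
  next
    assume "has_presentation 5 P10_2_7"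
    then show "type_10_2_7" unfolding has_presentation_iff using presents_type_10_2_7 by blast
  qed
qed

subsection \<open>Uniqueness\<close>

text \<open>The form on a standard basis, written without reference to an algebra, so that two
  algebras can be compared.\<close>

definition gram_value :: "basis_index \<Rightarrow> basis_index \<Rightarrow> 'k::field" where
  "gram_value i j = (if i = dual_index j then case j of Xi _ \<Rightarrow> - 1 | Yi _ \<Rightarrow> 1 else 0)"

lemma (in symplectic_alternating_algebra) frm_standard_basis:
  assumes "standard_basis n b" "i \<in> basis_indices n" "j \<in> basis_indices n"
  shows "\<lparr>b i, b j\<rparr> = gram_value i j"
  using frm_dual_vector[OF standard_basis_gram[OF assms(1)] assms(2) iffD2[OF dual_index_in assms(3)]]
  by (cases j) (auto simp: gram_value_def minus_equation_iff[of _ 1] split: if_splits)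

text \<open>Rotations of a listed triple keep its value and transpositions negate it. The right-hand
  side does not mention the algebra, so it agrees for any two algebras with this
  presentation.\<close>

lemma (in symplectic_alternating_algebra) presents_triple:
  assumes pres: "presents n P b" and P: "(i', j', k', r) \<in> P"
    and eq: "{i, j, k} = {i', j', k'}" and d: "i' \<noteq> j'" "j' \<noteq> k'" "i' \<noteq> k'"
  shows "\<lparr>b i \<cdot> b j, b k\<rparr> = (if (i, j, k) \<in> {(i', j', k'), (j', k', i'), (k', i', j')} then r else - r)"
proof -
  have r: "\<lparr>b i' \<cdot> b j', b k'\<rparr> = r"
    using bspec[OF pres[unfolded presents_def, THEN conjunct2, THEN conjunct1] P] unfolding prod.case .
  have r2: "\<lparr>b j' \<cdot> b k', b i'\<rparr> = r" using r frm_prd_cyclic[of "b i'" "b j'" "b k'"] by (rule subst[rotated])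
  have r3: "\<lparr>b k' \<cdot> b i', b j'\<rparr> = r" using r2 frm_prd_cyclic[of "b j'" "b k'" "b i'"] by (rule subst[rotated])
  have s: "\<lparr>b i' \<cdot> b k', b j'\<rparr> = - r" "\<lparr>b j' \<cdot> b i', b k'\<rparr> = - r" "\<lparr>b k' \<cdot> b j', b i'\<rparr> = - r"
    unfolding frm_prd_swap[of "b i'" "b k'" "b j'"] frm_prd_swap[of "b j'" "b i'" "b k'"]
      frm_prd_swap[of "b k'" "b j'" "b i'"] r r2 r3 by (rule refl)+
  show ?thesis
    using eq d by (rule insert3_eq_cases) (use d r r2 r3 s in auto)
qed

text \<open>The linear map matching the two bases preserves the form and all triples. Preserving the
  form makes it injective by non-degeneracy, and preserving triples makes it multiplicative, since
  the form recovers the product.\<close>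

lemma presents_saa_isomorphic:
  assumes L: "symplectic_alternating_algebra L" and M: "symplectic_alternating_algebra M"
    and pL: "symplectic_alternating_algebra.presents L n P b"
    and pM: "symplectic_alternating_algebra.presents M n P b'"
    and distinct: "\<And>i j k r. (i, j, k, r) \<in> P \<Longrightarrow> i \<noteq> j \<and> j \<noteq> k \<and> i \<noteq> k"
  shows "saa_isomorphic L M"
proof -
  interpret L: symplectic_alternating_algebra L by (rule L)
  interpret M: symplectic_alternating_algebra M by (rule M)
  let ?I = "basis_indices n"
  have bL: "L.standard_basis n b" using pL unfolding L.presents_def by (rule conjunct1)
  have bM: "M.standard_basis n b'" using pM unfolding M.presents_def by (rule conjunct1)
  have spanL: "L.span (b ` ?I) = UNIV" using bL unfolding L.standard_basis_def by blast
  have spanM: "M.span (b' ` ?I) = UNIV" using bM unfolding M.standard_basis_def by blast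
  define f where "f x = (\<Sum>i\<in>?I. scl M (frm L x (L.dual_vector b i)) (b' i))" for x
  have lin: "Vector_Spaces.linear (scl L) (scl M) f"
    unfolding Vector_Spaces.linear_iff
    by (simp add: L.vector_space_axioms M.vector_space_axioms f_def M.scale_left_distrib sum.distrib
        M.scale_sum_right)
  interpret f: Vector_Spaces.linear "scl L" "scl M" f by (rule lin)
  have fb: "f (b j) = b' j" if "j \<in> ?I" for j
  proof -
    have "f (b j) = (\<Sum>i\<in>?I. if j = i then b' i else 0)"
      unfolding f_def using L.frm_dual_vector[OF L.standard_basis_gram[OF bL] that]
      by (intro sum.cong) auto
    then show ?thesis using that finite_basis_indices by simp
  qed
  have span_all: "x \<in> S" if "L.subspace S" "\<And>i. i \<in> ?I \<Longrightarrow> b i \<in> S" for x S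
    using L.span_minimal[of "b ` ?I" S] that spanL by blast
  have frm1: "frm M (b' i) (f y) = frm L (b i) y" if i: "i \<in> ?I" for i y
  proof -
    have "y \<in> {y. frm M (b' i) (f y) = frm L (b i) y}"
    proof (rule span_all)
      show "L.subspace {y. frm M (b' i) (f y) = frm L (b i) y}"
        by (auto simp: L.subspace_def f.add f.scale f.zero)
      show "b j \<in> {y. frm M (b' i) (f y) = frm L (b i) y}" if j: "j \<in> ?I" for j
        using L.frm_standard_basis[OF bL i j] M.frm_standard_basis[OF bM i j] fb[OF j] by simp
    qed
    then show ?thesis by simp
  qed
  have frm: "frm M (f x) (f y) = frm L x y" for x y
  proof -
    have "x \<in> {x. frm M (f x) (f y) = frm L x y}"
    proof (rule span_all)
      show "L.subspace {x. frm M (f x) (f y) = frm L x y}"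
        by (auto simp: L.subspace_def f.add f.scale f.zero)
      show "b i \<in> {x. frm M (f x) (f y) = frm L x y}" if "i \<in> ?I" for i
        using frm1[OF that] fb[OF that] by simp
    qed
    then show ?thesis by simp
  qed
  have triple: "frm M (prd M (b' i) (b' j)) (b' k) = frm L (prd L (b i) (b j)) (b k)"
    if ijk: "i \<in> ?I" "j \<in> ?I" "k \<in> ?I" for i j k
  proof (cases "\<exists>i' j' k' r. (i', j', k', r) \<in> P \<and> {i, j, k} = {i', j', k'}")
    case True
    then obtain i' j' k' r where P: "(i', j', k', r) \<in> P" and eq: "{i, j, k} = {i', j', k'}" by blast
    have d: "i' \<noteq> j'" "j' \<noteq> k'" "i' \<noteq> k'" using distinct[OF P] by auto
    show ?thesis unfolding L.presents_triple[OF pL P eq d] M.presents_triple[OF pM P eq d] ..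
  next
    case False
    then have *: "\<forall>(i', j', k', r)\<in>P. {i, j, k} \<noteq> {i', j', k'}" by blast
    show ?thesis
      using pL[unfolded L.presents_def, THEN conjunct2, THEN conjunct2, THEN bspec, OF ijk(1),
          THEN bspec, OF ijk(2), THEN bspec, OF ijk(3), THEN mp, OF *]
        pM[unfolded M.presents_def, THEN conjunct2, THEN conjunct2, THEN bspec, OF ijk(1),
          THEN bspec, OF ijk(2), THEN bspec, OF ijk(3), THEN mp, OF *] by simp
  qed
  \<comment> \<open>The equality of triples is extended from basis vectors to all vectors one
    argument at a time, last argument first.\<close>
  have triple1: "frm M (prd M (b' i) (b' j)) (f z) = frm L (prd L (b i) (b j)) z"
    if i: "i \<in> ?I" and j: "j \<in> ?I" for i j z
  proof -
    have "z \<in> {z. frm M (prd M (b' i) (b' j)) (f z) = frm L (prd L (b i) (b j)) z}"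
    proof (rule span_all)
      show "L.subspace {z. frm M (prd M (b' i) (b' j)) (f z) = frm L (prd L (b i) (b j)) z}"
        by (auto simp: L.subspace_def f.add f.scale f.zero)
      show "b k \<in> {z. frm M (prd M (b' i) (b' j)) (f z) = frm L (prd L (b i) (b j)) z}" if k: "k \<in> ?I" for k
        using triple[OF i j k] fb[OF k] by simp
    qed
    then show ?thesis by simp
  qed
  have triple2: "frm M (prd M (b' i) (f y)) (f z) = frm L (prd L (b i) y) z" if i: "i \<in> ?I" for i y z
  proof -
    have "y \<in> {y. frm M (prd M (b' i) (f y)) (f z) = frm L (prd L (b i) y) z}"
    proof (rule span_all)
      show "L.subspace {y. frm M (prd M (b' i) (f y)) (f z) = frm L (prd L (b i) y) z}"
        by (auto simp: L.subspace_def f.add f.scale f.zero)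
      show "b k \<in> {y. frm M (prd M (b' i) (f y)) (f z) = frm L (prd L (b i) y) z}" if k: "k \<in> ?I" for k
        using triple1[OF i k] fb[OF k] by simp
    qed
    then show ?thesis by simp
  qed
  have triple3: "frm M (prd M (f x) (f y)) (f z) = frm L (prd L x y) z" for x y z
  proof -
    have "x \<in> {x. frm M (prd M (f x) (f y)) (f z) = frm L (prd L x y) z}"
    proof (rule span_all)
      show "L.subspace {x. frm M (prd M (f x) (f y)) (f z) = frm L (prd L x y) z}"
        by (auto simp: L.subspace_def f.add f.scale f.zero)
      show "b k \<in> {x. frm M (prd M (f x) (f y)) (f z) = frm L (prd L x y) z}" if k: "k \<in> ?I" for k
        using triple2[OF k] fb[OF k] by simp
    qed
    then show ?thesis by simp
  qed
  have "inj f"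
    unfolding f.inj_iff_eq_0
  proof (intro allI impI)
    fix x assume "f x = 0"
    then have "frm L x y = 0" for y using frm[of x y] by simp
    then show "x = 0" by (rule L.frm_nondegenerate)
  qed
  moreover have surj: "surj f"
  proof -
    have "f ` L.span (b ` ?I) = M.span (f ` b ` ?I)" by (rule f.span_image[symmetric])
    also have "f ` b ` ?I = b' ` ?I" using fb by (auto simp: image_image)
    finally show ?thesis using spanL spanM by simp
  qed
  ultimately have "bij f" by (rule bijI)
  moreover have "f (prd L x y) = prd M (f x) (f y)" for x y
  proof (rule M.frm_ext)
    fix w
    \<comment> \<open>Surjectivity lets every test vector be an image, so both sides become triples
      in L.\<close>
    obtain z where w: "w = f z" using surj by (rule surjE)
    show "frm M (f (prd L x y)) w = frm M (prd M (f x) (f y)) w"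
      unfolding w frm triple3 ..
  qed
  ultimately show ?thesis unfolding saa_isomorphic_def using lin frm by blast
qed

subsection \<open>Existence\<close>

definition unit_coord :: "basis_index \<Rightarrow> basis_index \<Rightarrow> 'k::field" where
  "unit_coord i j = (if i = j then 1 else 0)"

text \<open>The wedge product of three coordinate functionals: alternating, and 1 on the unit
  vectors at i, j, k when these are distinct.\<close>

definition det3 ::
  "basis_index \<Rightarrow> basis_index \<Rightarrow> basis_index \<Rightarrow> (basis_index \<Rightarrow> 'k::field) \<Rightarrow> (basis_index \<Rightarrow> 'k) \<Rightarrow> (basis_index \<Rightarrow> 'k) \<Rightarrow> 'k"
  where "det3 i j k x y z =
    x i * (y j * z k - y k * z j) - x j * (y i * z k - y k * z i) + x k * (y i * z j - y j * z i)"

definition model_triple ::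
  "(basis_index \<Rightarrow> 'k::field) \<Rightarrow> (basis_index \<Rightarrow> 'k) \<Rightarrow> (basis_index \<Rightarrow> 'k) \<Rightarrow> 'k" where
  "model_triple x y z = det3 (Xi 2) (Yi 3) (Yi 5) x y z + det3 (Xi 3) (Yi 4) (Yi 5) x y z +
     det3 (Xi 1) (Yi 2) (Yi 4) x y z + det3 (Yi 1) (Yi 2) (Yi 3) x y z"

definition model_form :: "(basis_index \<Rightarrow> 'k::field) \<Rightarrow> (basis_index \<Rightarrow> 'k) \<Rightarrow> 'k" where
  "model_form x y = (\<Sum>m\<in>{1..5}. x (Xi m) * y (Yi m) - x (Yi m) * y (Xi m))"

text \<open>Forced by the requirement that (xy, z) be the trilinear form: the coordinate at x_m is
  the pairing with y_m, and the one at y_m is minus the pairing with x_m.\<close>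

fun model_product :: "(basis_index \<Rightarrow> 'k::field) \<Rightarrow> (basis_index \<Rightarrow> 'k) \<Rightarrow> basis_index \<Rightarrow> 'k" where
  "model_product x y (Xi m) = model_triple x y (unit_coord (Yi m))"
| "model_product x y (Yi m) = - model_triple x y (unit_coord (Xi m))"

lemma atLeastAtMost_1_5: "{1..5::nat} = {1, 2, 3, 4, 5}" by auto

lemma model_form_product: "model_form (model_product x y) z = model_triple x y z"
  unfolding model_form_def atLeastAtMost_1_5
  by (simp add: model_triple_def det3_def unit_coord_def algebra_simps)

text \<open>Each of the six terms of the determinant is non-zero only if i, j, k is a permutation of
  the three positions.\<close>

lemma det3_unit_eq_0:
  assumes "{i, j, k} \<noteq> {i', j', k'}"
  shows "det3 i' j' k' (unit_coord i) (unit_coord j) (unit_coord k) = (0::'k::field)"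
proof -
  have *: "unit_coord i l * (unit_coord j m * unit_coord k n) = (0::'k)" if "{l, m, n} = {i', j', k'}" for l m n
    using assms that by (auto simp: unit_coord_def)
  have z: "unit_coord i i' * (unit_coord j j' * unit_coord k k') = (0::'k)"
    "unit_coord i i' * (unit_coord j k' * unit_coord k j') = (0::'k)"
    "unit_coord i j' * (unit_coord j i' * unit_coord k k') = (0::'k)"
    "unit_coord i j' * (unit_coord j k' * unit_coord k i') = (0::'k)"
    "unit_coord i k' * (unit_coord j i' * unit_coord k j') = (0::'k)"
    "unit_coord i k' * (unit_coord j j' * unit_coord k i') = (0::'k)"
    by (rule *, blast)+
  show ?thesis unfolding det3_def right_diff_distrib z by simp
qed

lemma model_triple_unit_eq_0:
  assumes "\<And>i' j' k' r. (i', j', k', r) \<in> (P10_2_7 :: 'k::field presentation) \<Longrightarrow> {i, j, k} \<noteq> {i', j', k'}"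
  shows "model_triple (unit_coord i) (unit_coord j) (unit_coord k) = (0::'k)"
proof -
  have ne: "{i, j, k} \<noteq> {Xi 2, Yi 3, Yi 5}" "{i, j, k} \<noteq> {Xi 3, Yi 4, Yi 5}"
    "{i, j, k} \<noteq> {Xi 1, Yi 2, Yi 4}" "{i, j, k} \<noteq> {Yi 1, Yi 2, Yi 3}"
    by (rule assms[of _ _ _ 1], simp add: P10_2_7_def)+
  show ?thesis unfolding model_triple_def ne[THEN det3_unit_eq_0] by simp
qed

lemma model_algebra_exists:
  "\<exists>L :: ('k::field, 'k ^ 10) form_algebra.
     symplectic_alternating_algebra L \<and> symplectic_alternating_algebra.has_presentation L 5 P10_2_7"
proof -
  let ?I = "basis_indices 5"
  have "card ?I = card (UNIV :: 10 set)" by (simp add: card_basis_indices)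
  then obtain e :: "basis_index \<Rightarrow> 10" where e: "bij_betw e ?I UNIV"
    using finite_same_card_bij[OF finite_basis_indices, of "UNIV :: 10 set" 5] by auto
  have inj: "e i = e j \<longleftrightarrow> i = j" if "i \<in> ?I" "j \<in> ?I" for i j
    using e that unfolding bij_betw_def inj_on_def by blast
  define d where "d = the_inv_into ?I e"
  have de: "d (e i) = i" if "i \<in> ?I" for i
    unfolding d_def using e that by (intro the_inv_into_f_f) (auto simp: bij_betw_def)
  have ed: "e (d j) = j" "d j \<in> ?I" for j
  proof -
    obtain i where i: "i \<in> ?I" "j = e i" using e unfolding bij_betw_def by blast
    then show "e (d j) = j" "d j \<in> ?I" using de by simp_all
  qed
  \<comment> \<open>Vectors of \<open>'k ^ 10\<close> are read as functions on basis indices through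
    the bijection \<open>e\<close>; \<open>co\<close> and \<open>vec\<close> translate between the
    two.\<close>
  define co :: "'k ^ 10 \<Rightarrow> basis_index \<Rightarrow> 'k" where "co w i = w $ e i" for w i
  define vec :: "(basis_index \<Rightarrow> 'k) \<Rightarrow> 'k ^ 10" where "vec g = (\<chi> j. g (d j))" for g
  have co_vec: "co (vec g) i = g i" if "i \<in> ?I" for g i
    using that by (simp add: co_def vec_def de)
  have ext: "w = z" if "\<And>i. i \<in> ?I \<Longrightarrow> co w i = co z i" for w z
  proof -
    have "w $ j = z $ j" for j using that[OF ed(2), of j] by (simp add: co_def ed(1))
    then show ?thesis by (simp add: vec_eq_iff)
  qed
  have co_lin: "co (w + z) = (\<lambda>i. co w i + co z i)" "co (s *s w) = (\<lambda>i. s * co w i)" for w z s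
    by (auto simp: co_def)
  have I: "Xi 1 \<in> ?I" "Xi 2 \<in> ?I" "Xi 3 \<in> ?I" "Xi 4 \<in> ?I" "Xi 5 \<in> ?I"
    "Yi 1 \<in> ?I" "Yi 2 \<in> ?I" "Yi 3 \<in> ?I" "Yi 4 \<in> ?I" "Yi 5 \<in> ?I"
    unfolding basis_indices_5 by simp_all
  have mem: "Xi m \<in> ?I" "Yi m \<in> ?I" if "m \<in> {1..5}" for m using that by (auto simp: basis_indices_def)
  define L :: "('k, 'k ^ 10) form_algebra" where
    "L = \<lparr>scl = (*s), frm = (\<lambda>x y. model_form (co x) (co y)),
          prd = (\<lambda>x y. vec (model_product (co x) (co y)))\<rparr>"
  \<comment> \<open>\<open>vec\<close> forgets the values outside the ten indices, but the form, and
    likewise the trilinear form, reads only those ten.\<close>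
  have form_vec: "model_form (co (vec g)) h = model_form g h" "model_form h (co (vec g)) = model_form h g" for g h
    unfolding model_form_def using mem by (simp_all add: co_vec)
  have triple_vec: "model_triple (co (vec g)) x y = model_triple g x y"
    "model_triple x (co (vec g)) y = model_triple x g y"
    "model_triple x y (co (vec g)) = model_triple x y g" for g x y
    unfolding model_triple_def det3_def I[THEN co_vec] by (rule refl)+
  have triple_lin: "model_triple (\<lambda>i. x i + x' i) y z = model_triple x y z + model_triple x' y z"
    "model_triple (\<lambda>i. s * x i) y z = s * model_triple x y z"
    "model_triple y (\<lambda>i. x i + x' i) z = model_triple y x z + model_triple y x' z"
    "model_triple y (\<lambda>i. s * x i) z = s * model_triple y x z"
    "model_triple x x z = 0"
    "model_triple x y z = model_triple y z x" for x x' y z :: "basis_index \<Rightarrow> 'k" and s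
    unfolding model_triple_def det3_def by (simp_all add: algebra_simps)
  have prd_eqI: "vec g = w" if "\<And>i. i \<in> ?I \<Longrightarrow> g i = co w i" for g w
    using that by (intro ext) (simp add: co_vec)
  have L: "symplectic_alternating_algebra L"
  proof (intro symplectic_alternating_algebra.intro symplectic_alternating_algebra_axioms.intro)
    show vs: "vector_space (scl L)" by (simp add: L_def vec.vector_space_axioms)
    show "\<exists>B. finite B \<and> module.span (scl L) B = UNIV"
      using vec.finite_Basis vec.span_Basis by (auto simp: L_def)
    show "Vector_Spaces.linear (scl L) (*) (\<lambda>x. frm L x y)" for y
      unfolding Vector_Spaces.linear_iff
      by (simp add: L_def vec.vector_space_axioms vector_space_over_itself.vector_space_axioms
          model_form_def co_lin algebra_simps sum.distrib sum_subtractf sum_distrib_left)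
    show "Vector_Spaces.linear (scl L) (*) (\<lambda>y. frm L x y)" for x
      unfolding Vector_Spaces.linear_iff
      by (simp add: L_def vec.vector_space_axioms vector_space_over_itself.vector_space_axioms
          model_form_def co_lin algebra_simps sum.distrib sum_subtractf sum_distrib_left)
    show "frm L x x = 0" for x
      by (simp add: L_def model_form_def mult.commute)
    show "x = 0" if "\<And>y. frm L x y = 0" for x
    proof (rule ext)
      fix i assume i: "i \<in> ?I"
      have f: "model_form (co x) (unit_coord j) = 0" for j
        using that[of "vec (unit_coord j)"] by (simp add: L_def form_vec)
      \<comment> \<open>Pairing with the unit vector at the dual index isolates the coordinate at
        \<open>i\<close> up to sign.\<close>
      show "co x i = co 0 i"
        using i f[of "dual_index i"] unfolding basis_indices_5 model_form_def atLeastAtMost_1_5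
        by (auto simp: unit_coord_def co_def)
    qed
    show "Vector_Spaces.linear (scl L) (scl L) (\<lambda>x. prd L x y)" for y
      unfolding Vector_Spaces.linear_iff
    proof (intro conjI allI vs)
      fix a b c
      show "prd L (a + b) y = prd L a y + prd L b y"
        unfolding L_def form_algebra.simps
      proof (rule prd_eqI)
        fix i assume "i \<in> ?I"
        then show "model_product (co (a + b)) (co y) i =
            co (vec (model_product (co a) (co y)) + vec (model_product (co b) (co y))) i"
          by (cases i) (simp_all add: co_lin co_vec triple_lin)
      qed
      show "prd L (scl L c a) y = scl L c (prd L a y)"
        unfolding L_def form_algebra.simps
      proof (rule prd_eqI)
        fix i assume "i \<in> ?I"
        then show "model_product (co (c *s a)) (co y) i = co (c *s vec (model_product (co a) (co y))) i"
          by (cases i) (simp_all add: co_lin co_vec triple_lin)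
      qed
    qed
    show "Vector_Spaces.linear (scl L) (scl L) (\<lambda>y. prd L x y)" for x
      unfolding Vector_Spaces.linear_iff
    proof (intro conjI allI vs)
      fix a b c
      show "prd L x (a + b) = prd L x a + prd L x b"
        unfolding L_def form_algebra.simps
      proof (rule prd_eqI)
        fix i assume "i \<in> ?I"
        then show "model_product (co x) (co (a + b)) i =
            co (vec (model_product (co x) (co a)) + vec (model_product (co x) (co b))) i"
          by (cases i) (simp_all add: co_lin co_vec triple_lin)
      qed
      show "prd L x (scl L c a) = scl L c (prd L x a)"
        unfolding L_def form_algebra.simps
      proof (rule prd_eqI)
        fix i assume "i \<in> ?I"
        then show "model_product (co x) (co (c *s a)) i = co (c *s vec (model_product (co x) (co a))) i"
          by (cases i) (simp_all add: co_lin co_vec triple_lin)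
      qed
    qed
    show "prd L x x = 0" for x
      unfolding L_def form_algebra.simps
    proof (rule prd_eqI)
      fix i
      show "model_product (co x) (co x) i = co 0 i" by (cases i) (simp_all add: triple_lin(5) co_def)
    qed
    show "frm L (prd L x y) z = frm L (prd L y z) x" for x y z
      unfolding L_def form_algebra.simps form_vec model_form_product by (rule triple_lin(6))
  qed
  interpret L: symplectic_alternating_algebra L by (rule L)
  define b where "b i = vec (unit_coord i)" for i
  have T: "frm L (prd L (b i) (b j)) (b k) = model_triple (unit_coord i) (unit_coord j) (unit_coord k)" for i j k
    by (simp add: L_def b_def form_vec model_form_product triple_vec)
  have F: "frm L (b i) (b j) = model_form (unit_coord i) (unit_coord j)" for i j
    by (simp add: L_def b_def form_vec)
  have "L.dim UNIV = 10"
    using vec_dim_card[where 'a = 'k and 'n = 10] by (simp add: L_def)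
  moreover have "L.gram_standard 5 b"
    unfolding L.gram_standard_def F model_form_def atLeastAtMost_1_5 by (simp add: unit_coord_def)
  ultimately have "L.standard_basis 5 b" by (intro L.standard_basisI) simp_all
  moreover have "\<forall>(i, j, k, r)\<in>P10_2_7. frm L (prd L (b i) (b j)) (b k) = r"
    unfolding T P10_2_7_def by (simp add: model_triple_def det3_def unit_coord_def)
  moreover have "\<forall>i\<in>?I. \<forall>j\<in>?I. \<forall>k\<in>?I.
      (\<forall>(i', j', k', r)\<in>(P10_2_7 :: 'k presentation). {i, j, k} \<noteq> {i', j', k'}) \<longrightarrow>
      frm L (prd L (b i) (b j)) (b k) = 0"
  proof (intro ballI impI)
    fix i j k
    assume *: "\<forall>(i', j', k', r)\<in>(P10_2_7 :: 'k presentation). {i, j, k} \<noteq> {i', j', k'}"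
    show "frm L (prd L (b i) (b j)) (b k) = 0"
      unfolding T
    proof (rule model_triple_unit_eq_0)
      fix i' j' k' and r :: 'k assume P: "(i', j', k', r) \<in> P10_2_7"
      show "{i, j, k} \<noteq> {i', j', k'}" using bspec[OF * P] unfolding prod.case .
    qed
  qed
  ultimately have "L.has_presentation 5 P10_2_7" unfolding L.has_presentation_def by blast
  then show ?thesis using L by blast
qed

theorem proposition3p7:
  shows "(\<exists>L :: ('k::field, 'k ^ 10) form_algebra.
            symplectic_alternating_algebra L \<and> symplectic_alternating_algebra.type_10_2_7 L)
       \<and> (\<forall>(L :: ('k, 'v::ab_group_add) form_algebra) (M :: ('k, 'w::ab_group_add) form_algebra).
            symplectic_alternating_algebra L \<and> symplectic_alternating_algebra.type_10_2_7 L \<and>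
            symplectic_alternating_algebra M \<and> symplectic_alternating_algebra.type_10_2_7 M
            \<longrightarrow> saa_isomorphic L M)
       \<and> (\<forall>L :: ('k, 'v) form_algebra. symplectic_alternating_algebra L \<longrightarrow>
            (symplectic_alternating_algebra.type_10_2_7 L \<longleftrightarrow>
             symplectic_alternating_algebra.has_presentation L 5 P10_2_7))"
proof (intro conjI allI impI)
  obtain L :: "('k, 'k ^ 10) form_algebra" where L: "symplectic_alternating_algebra L"
    and p: "symplectic_alternating_algebra.has_presentation L 5 P10_2_7"
    using model_algebra_exists by blast
  show "\<exists>L :: ('k, 'k ^ 10) form_algebra.
      symplectic_alternating_algebra L \<and> symplectic_alternating_algebra.type_10_2_7 L"
    using L type_10_2_7_iff_has_presentation[OF L] p by blast
next
  fix L :: "('k, 'v) form_algebra" and M :: "('k, 'w) form_algebra"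
  assume "symplectic_alternating_algebra L \<and> symplectic_alternating_algebra.type_10_2_7 L \<and>
    symplectic_alternating_algebra M \<and> symplectic_alternating_algebra.type_10_2_7 M"
  then have L: "symplectic_alternating_algebra L" and M: "symplectic_alternating_algebra M"
    and "symplectic_alternating_algebra.has_presentation L 5 P10_2_7"
      "symplectic_alternating_algebra.has_presentation M 5 P10_2_7"
    using type_10_2_7_iff_has_presentation by blast+
  then obtain b b' where
    "symplectic_alternating_algebra.presents L 5 P10_2_7 b"
    "symplectic_alternating_algebra.presents M 5 P10_2_7 b'"
    using symplectic_alternating_algebra.has_presentation_iff[OF L]
      symplectic_alternating_algebra.has_presentation_iff[OF M] by blast
  then show "saa_isomorphic L M"
    by (rule presents_saa_isomorphic[OF L M]) (rule P10_2_7_distinct)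
next
  fix L :: "('k, 'v) form_algebra"
  assume "symplectic_alternating_algebra L"
  then show "symplectic_alternating_algebra.type_10_2_7 L \<longleftrightarrow>
      symplectic_alternating_algebra.has_presentation L 5 P10_2_7"
    by (rule type_10_2_7_iff_has_presentation)
qed

end
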